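(* Let $\mathcal{R},\mathcal{S}$ be noncrossing partitions of $\{1,\dots,n\}$ such that $\mathcal{S}$ is a refinement of $\mathcal{R}$. A subset $T$ of $E(\mathcal{S},\mathcal{R})$ gives a cluster morphism $[T]:\mathcal{R}\to\mathcal{S}$ if and only if the elements of $T$ are pairwise compatible and $T$ is maximal with this property.
   Context: Noncrossing partitions. Let $V$ be a finite totally ordered set, regarded as a subset of $\mathbb{R}$. A partition $\mathcal{S}$ of $V$ (a set of disjoint nonempty subsets, called parts, with union $V$) is noncrossing if there are no $a<b<c<d$ with $a,c$ in one part and $b,d$ in another. $\mathcal{S}$ is a refinement of $\mathcal{R}$ if every part of $\mathcal{S}$ lies in a part of $\mathcal{R}$. The support of a part $A$ is the closed interval $supp\,A=[\min A,\max A]$. Vertical ordering of parts: $X<Y$ if $supp\,X\subset supp\,Y$. $A$ covers $B$ if $A$ is directly above $B$ in the Hasse diagram of the vertical ordering. Parts $A,B$ with disjoint supports are laterally ordered: $A$ is to the left of $B$ if every element of $A$ is less than every element of $B$. Two distinct parts $A,B$ are parallel if either both are maximal in the vertical ordering, or both are covered by the same part $C$ and no element of $C$ lies between $A$ and $B$. A parallel set is a maximal set of pairwise parallel parts; it is totally ordered laterally. Edges. $\mathbb{Z}\mathcal{S}$ is the free abelian group on $\mathcal{S}$. $E(\mathcal{S})\subset\mathbb{Z}\mathcal{S}$ is the set of all $A-B$ (a directed edge from $B$ to $A$) where $A,B$ are parallel parts or $A$ covers $B$. If $\mathcal{S}$ refines $\mathcal{R}$, with induced surjection $\pi:\mathcal{S}\to\mathcal{R}$,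 then $E(\mathcal{S},\mathcal{R})=\coprod_{W\in\mathcal{R}}E(\pi^{-1}(W))\subseteq E(\mathcal{S})$, where $\pi^{-1}(W)$ is viewed as a noncrossing partition of $W$. Trees. A directed forest on a finite set $S$ is a linearly independent set of edges $w-v\in\mathbb{Z}S$ ($v\ne w$); a tree is a forest of maximal size. It gives the partial order $v\le w$ if there is a directed path from $v$ to $w$. A tree is rooted if there is a unique maximal element, the root. If $w-v$ is an edge, $v$ is a child of $w$. A binary tree on a totally ordered set $\{v_1,\dots,v_m\}$ (ordered by index) is a rooted tree $T$ such that, in its partial order: (i) if $v_j-v_i\in T$ then $v_k<v_i$ for all $k$ strictly between $i$ and $j$; (ii) every $v_i$ has at most two children; (iii) if $v_i$ has two children $v_j,v_k$ then $i$ lies between $j$ and $k$. A binary forest on $\mathcal{S}$ is a union of binary trees, one on each parallel set of $\mathcal{S}$ (with the lateral order). The rooted tree generated by a binary forest $F$ on $\mathcal{S}$ is the unique rooted tree $T$ on $\mathcal{S}$ with $F\subseteq T\subseteq E(\mathcal{S})$: it is obtained by adding, for each nonmaximal parallel set with root $R$ covered by the part $C$, the edge $C-R$. Cluster morphisms. If $\mathcal{S}$ refines $\mathcal{R}$, a cluster morphism $[T]:\mathcal{R}\to\mathcal{S}$ is given by $T=\coprod_{W\in\mathcal{R}}T_W\subseteq E(\mathcal{S},\mathcal{R})$, where each $T_W$ is the rooted tree generated by a binary forest on $\pi^{-1}(W)$. Two elements of $E(\mathcal{S},\mathcal{R})$ are compatible if some cluster morphism $\mathcal{R}\to\mathcal{S}$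 contains both. *)

theory Defs
  imports Complex_Main "HOL-Library.Disjoint_Sets" "HOL-Library.Poly_Mapping"
begin

definition noncrossing :: "'a::linorder set set \<Rightarrow> bool" where
  "noncrossing S \<longleftrightarrow>
     (\<forall>A\<in>S. \<forall>B\<in>S. A \<noteq> B \<longrightarrow>
        \<not> (\<exists>a b c d. a < b \<and> b < c \<and> c < d \<and> a \<in> A \<and> c \<in> A \<and> b \<in> B \<and> d \<in> B))"

definition noncrossing_partition :: "'a::linorder set \<Rightarrow> 'a set set \<Rightarrow> bool" where
  "noncrossing_partition V S \<longleftrightarrow> partition_on V S \<and> noncrossing S"

text \<open>The order interval: inclusion and disjointness of supports do not depend on whether the
  interval is taken in \<open>'a\<close> or in the reals.\<close>

definition supp :: "'a::linorder set \<Rightarrow> 'a set" where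
  "supp A = {Min A..Max A}"

definition vless :: "'a::linorder set \<Rightarrow> 'a set \<Rightarrow> bool" where
  "vless X Y \<longleftrightarrow> supp X \<subset> supp Y"

definition vmaximal :: "'a::linorder set set \<Rightarrow> 'a set \<Rightarrow> bool" where
  "vmaximal S A \<longleftrightarrow> A \<in> S \<and> \<not> (\<exists>B\<in>S. vless A B)"

definition covers :: "'a::linorder set set \<Rightarrow> 'a set \<Rightarrow> 'a set \<Rightarrow> bool" where
  "covers S A B \<longleftrightarrow>
     A \<in> S \<and> B \<in> S \<and> vless B A \<and> \<not> (\<exists>C\<in>S. vless B C \<and> vless C A)"

text \<open>For nonempty parts the following implies that the supports are disjoint.\<close>

definition left_of :: "'a::linorder set \<Rightarrow> 'a set \<Rightarrow> bool" where
  "left_of A B \<longleftrightarrow> (\<forall>a\<in>A. \<forall>b\<in>B. a < b)"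

definition strictly_between :: "('b \<Rightarrow> 'b \<Rightarrow> bool) \<Rightarrow> 'b \<Rightarrow> 'b \<Rightarrow> 'b \<Rightarrow> bool" where
  "strictly_between lt x y z \<longleftrightarrow> (lt x y \<and> lt y z) \<or> (lt z y \<and> lt y x)"

definition parallel :: "'a::linorder set set \<Rightarrow> 'a set \<Rightarrow> 'a set \<Rightarrow> bool" where
  "parallel S A B \<longleftrightarrow>
     A \<in> S \<and> B \<in> S \<and> A \<noteq> B \<and>
     ((vmaximal S A \<and> vmaximal S B) \<or>
      (\<exists>C. covers S C A \<and> covers S C B \<and> \<not> (\<exists>c\<in>C. strictly_between left_of A {c} B)))"

definition parallel_set :: "'a::linorder set set \<Rightarrow> 'a set set \<Rightarrow> bool" where
  "parallel_set S P \<longleftrightarrow>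
     P \<subseteq> S \<and> pairwise (parallel S) P \<and>
     (\<forall>Q. P \<subseteq> Q \<and> Q \<subseteq> S \<and> pairwise (parallel S) Q \<longrightarrow> Q = P)"

text \<open>
  The group \<open>\<int>S\<close> consists of the finitely supported functions to the integers whose support
  lies in \<open>S\<close>; a directed edge from \<open>v\<close> to \<open>w\<close> is the element \<open>w - v\<close>.
\<close>

definition edge :: "'b \<Rightarrow> 'b \<Rightarrow> 'b \<Rightarrow>\<^sub>0 int" where
  "edge v w = frag_of w - frag_of v"

definition nc_edges :: "'a::linorder set set \<Rightarrow> ('a set \<Rightarrow>\<^sub>0 int) set" where
  "nc_edges S = {edge B A |A B. parallel S A B \<or> covers S A B}"

text \<open>The preimage of \<open>W\<close> under the surjection to the coarser partition.\<close>

definition parts_in :: "'a set set \<Rightarrow> 'a set \<Rightarrow> 'a set set" where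
  "parts_in S W = {A \<in> S. A \<subseteq> W}"

definition rel_edges :: "'a::linorder set set \<Rightarrow> 'a set set \<Rightarrow> ('a set \<Rightarrow>\<^sub>0 int) set" where
  "rel_edges S R = (\<Union>W\<in>R. nc_edges (parts_in S W))"

global_interpretation frag: module frag_cmul
  by unfold_locales (simp_all add: frag_cmul_distrib frag_cmul_distrib2)

definition directed_forest :: "'b set \<Rightarrow> ('b \<Rightarrow>\<^sub>0 int) set \<Rightarrow> bool" where
  "directed_forest S F \<longleftrightarrow>
     F \<subseteq> {edge v w |v w. v \<in> S \<and> w \<in> S \<and> v \<noteq> w} \<and> frag.independent F"

definition directed_tree :: "'b set \<Rightarrow> ('b \<Rightarrow>\<^sub>0 int) set \<Rightarrow> bool" where
  "directed_tree S T \<longleftrightarrow>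
     directed_forest S T \<and> (\<forall>F. directed_forest S F \<longrightarrow> card F \<le> card T)"

definition tree_le :: "('b \<Rightarrow>\<^sub>0 int) set \<Rightarrow> 'b \<Rightarrow> 'b \<Rightarrow> bool" where
  "tree_le T v w \<longleftrightarrow> (\<lambda>x y. edge x y \<in> T)\<^sup>*\<^sup>* v w"

definition tree_less :: "('b \<Rightarrow>\<^sub>0 int) set \<Rightarrow> 'b \<Rightarrow> 'b \<Rightarrow> bool" where
  "tree_less T v w \<longleftrightarrow> tree_le T v w \<and> v \<noteq> w"

definition rooted_tree :: "'b set \<Rightarrow> ('b \<Rightarrow>\<^sub>0 int) set \<Rightarrow> bool" where
  "rooted_tree S T \<longleftrightarrow>
     directed_tree S T \<and> (\<exists>!r. r \<in> S \<and> \<not> (\<exists>w\<in>S. tree_less T r w))"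

definition children :: "'b set \<Rightarrow> ('b \<Rightarrow>\<^sub>0 int) set \<Rightarrow> 'b \<Rightarrow> 'b set" where
  "children S T w = {v \<in> S. edge v w \<in> T}"

text \<open>The relation \<open>lt\<close> is the strict total order on the vertex set \<open>S\<close>.\<close>

definition binary_tree :: "('b \<Rightarrow> 'b \<Rightarrow> bool) \<Rightarrow> 'b set \<Rightarrow> ('b \<Rightarrow>\<^sub>0 int) set \<Rightarrow> bool" where
  "binary_tree lt S T \<longleftrightarrow>
     rooted_tree S T \<and>
     (\<forall>x\<in>S. \<forall>y\<in>S. edge x y \<in> T \<longrightarrow>
        (\<forall>z\<in>S. strictly_between lt x z y \<longrightarrow> tree_less T z x)) \<and>
     (\<forall>x\<in>S. card (children S T x) \<le> 2) \<and>
     (\<forall>x\<in>S. \<forall>y\<in>children S T x. \<forall>z\<in>children S T x. y \<noteq> z \<longrightarrow> strictly_between lt y x z)"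

definition binary_forest :: "'a::linorder set set \<Rightarrow> ('a set \<Rightarrow>\<^sub>0 int) set \<Rightarrow> bool" where
  "binary_forest S F \<longleftrightarrow>
     (\<exists>t. (\<forall>P. parallel_set S P \<longrightarrow> binary_tree left_of P (t P)) \<and>
          F = (\<Union>P\<in>Collect (parallel_set S). t P))"

text \<open>Existence and uniqueness: exactly one edge joins each nonmaximal parallel set to the part \<open>C\<close>
  covering it, and it must be \<open>C - R\<close> for the root \<open>R\<close> of that set, as otherwise \<open>R\<close> would be a
  second maximal element.\<close>

definition generated_tree :: "'a::linorder set set \<Rightarrow> ('a set \<Rightarrow>\<^sub>0 int) set \<Rightarrow> ('a set \<Rightarrow>\<^sub>0 int) set" where
  "generated_tree S F = (THE T. rooted_tree S T \<and> F \<subseteq> T \<and> T \<subseteq> nc_edges S)"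

text \<open>\<open>cluster_morphism R S T\<close>: the set of edges \<open>T\<close> gives a cluster morphism from \<open>R\<close> to its
  refinement \<open>S\<close>.\<close>

definition cluster_morphism ::
    "'a::linorder set set \<Rightarrow> 'a set set \<Rightarrow> ('a set \<Rightarrow>\<^sub>0 int) set \<Rightarrow> bool" where
  "cluster_morphism R S T \<longleftrightarrow>
     (\<exists>f. (\<forall>W\<in>R. binary_forest (parts_in S W) (f W)) \<and>
          T = (\<Union>W\<in>R. generated_tree (parts_in S W) (f W)))"

definition compatible ::
    "'a::linorder set set \<Rightarrow> 'a set set \<Rightarrow> ('a set \<Rightarrow>\<^sub>0 int) \<Rightarrow> ('a set \<Rightarrow>\<^sub>0 int) \<Rightarrow> bool" where
  "compatible R S x y \<longleftrightarrow>
     x \<in> rel_edges S R \<and> y \<in> rel_edges S R \<and> (\<exists>T. cluster_morphism R S T \<and> x \<in> T \<and> y \<in> T)"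

end

theory Submission
  imports Defs
begin

text \<open>Binary trees on a totally ordered set are binary search trees. Two arcs of such a tree satisfy an
  explicit noncrossing condition, and conversely every set of arcs satisfying it pairwise extends to a
  binary tree: some vertex has no outgoing arc and lies under no arc, so it can be made the root, and
  the two sides are treated recursively. A root required by an edge to the covering part is handled in
  the same way. Hence pairwise compatible sets of edges always extend to cluster morphisms, while a
  cluster morphism contained in another one equals it because rooted trees on the same vertices have
  equally many edges.\<close>

section \<open>Trees as parent relations\<close>

text \<open>Compatibility of two edges says only that some cluster morphism contains both, and
  different pairs may come from different morphisms. Gluing therefore needs a criterion that
  mentions the two edges alone. Condition (i) supplies it: a vertex under an arc lies below the tail
  of that arc, so its way up the tree cannot leave the arc without meeting the tail. Hence an arc
  that starts under another one also ends under it, or at its tail, and an arc that ends under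
  another one also starts under it.

  Linear independence is removed first: an independent edge set has fewer edges than vertices, so a
  rooted tree is the same as a parent function.

  The criterion concerns only edges whose sources lie in one parallel set. Parallel sets are the
  classes of an equivalence relation, every edge has its source in exactly one of them, and an edge
  to a covering part says no more than that its source is the root of its class. The choices for
  different classes, and for different parts of the coarser partition, are therefore
  independent.\<close>

definition arcs :: "('b \<Rightarrow>\<^sub>0 int) set \<Rightarrow> ('b \<times> 'b) set" where
  "arcs T = {(v, w). edge v w \<in> T}"

text \<open>The root is given as a set \<open>D\<close> of at most one vertex because the recursion
  on binary trees splits the vertices into two sides, and an empty side has to count as a tree. On a
  nonempty \<open>V\<close> the last clause forces \<open>D\<close> to be a singleton.\<close>

definition parent_tree :: "'b set \<Rightarrow> 'b set \<Rightarrow> ('b \<times> 'b) set \<Rightarrow> bool" where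
  "parent_tree V D E \<longleftrightarrow> D \<subseteq> V \<and> (\<forall>c\<in>D. \<forall>d\<in>D. c = d) \<and> E \<subseteq> V \<times> V \<and> single_valued E \<and>
     Domain E = V - D \<and> (\<forall>v\<in>V. \<exists>d\<in>D. (v, d) \<in> E\<^sup>*)"

section \<open>Edge vectors and their endpoints\<close>

lemma lookup_edge: "poly_mapping.lookup (edge v w) x = (if x = w then 1 else 0) - (if x = v then 1 else 0)"
  by (simp add: edge_def lookup_minus)

lemma edge_refl [simp]: "edge v v = 0"
  by (simp add: edge_def)

lemma edge_eq_0_iff [simp]: "edge v w = 0 \<longleftrightarrow> v = w"
proof
  assume "edge v w = 0"
  then have "poly_mapping.lookup (edge v w) w = 0"
    by simp
  then show "v = w"
    by (simp add: lookup_edge split: if_splits)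
qed simp

lemma edge_inject:
  assumes "edge v w = edge v' w'" and "v \<noteq> w"
  shows "v = v' \<and> w = w'"
proof -
  have "poly_mapping.lookup (edge v w) x = poly_mapping.lookup (edge v' w') x" for x
    using assms by simp
  from this[of v] this[of w] assms(2) show ?thesis
    by (auto simp: lookup_edge split: if_splits)
qed

text \<open>Only loops lose information: every \<open>edge v v\<close> is 0, so a single loop in
  \<open>E\<close> would put all loops into the recovered relation. Any other edge vector reveals
  its two ends by the signs of its coefficients.\<close>

lemma arcs_edge_image:
  assumes "irrefl E"
  shows "arcs (case_prod edge ` E) = E"
proof -
  have "(v, w) = (a, b)" if "edge v w = edge a b" "(a, b) \<in> E" for v w a b
    using edge_inject[of a b v w] that assms by (auto simp: irrefl_def)
  then show ?thesis
    by (auto simp: arcs_def)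
qed

lemma edge_image_arcs:
  assumes "T \<subseteq> {edge v w |v w. Q v w}"
  shows "case_prod edge ` arcs T = T"
proof (intro equalityI subsetI)
  fix e assume "e \<in> T"
  moreover from this assms obtain v w where "e = edge v w"
    by blast
  ultimately show "e \<in> case_prod edge ` arcs T"
    by (intro image_eqI[of _ _ "(v, w)"]) (auto simp: arcs_def)
qed (auto simp: arcs_def)

lemma tree_le_iff: "tree_le T v w \<longleftrightarrow> (v, w) \<in> (arcs T)\<^sup>*"
  by (simp add: tree_le_def arcs_def rtranclp_rtrancl_eq [symmetric])

section \<open>The size of a directed forest\<close>

lemma finite_edge_set: "finite V \<Longrightarrow> finite {edge v w |v w. v \<in> V \<and> w \<in> V \<and> v \<noteq> w}"
  by (rule finite_subset[of _ "case_prod edge ` (V \<times> V)"]) auto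

lemma directed_forest_finite: "finite V \<Longrightarrow> directed_forest V F \<Longrightarrow> finite F"
  unfolding directed_forest_def by (elim conjE) (rule finite_subset[OF _ finite_edge_set])

lemma independent_sum_zeroD:
  assumes "frag.independent F" "finite t" "t \<subseteq> F" "(\<Sum>e\<in>t. frag_cmul (u e) e) = 0" "e \<in> t"
  shows "u e = 0"
  using assms unfolding frag.dependent_explicit by blast

text \<open>Contracting an edge turns an independent edge set into one on fewer vertices.\<close>

lemma directed_forest_card:
  assumes "finite V" "V \<noteq> {}" "directed_forest V F"
  shows "card F < card V"
  using assms
proof (induction "card V" arbitrary: V F rule: less_induct)
  case less
  have ind: "frag.independent F" and sub: "F \<subseteq> {edge v w |v w. v \<in> V \<and> w \<in> V \<and> v \<noteq> w}"
    using less.prems(3) by (auto simp: directed_forest_def)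
  have fin: "finite F"
    using directed_forest_finite less.prems by blast
  show ?case
  proof (cases "F = {}")
    case True
    then show ?thesis
      using less.prems by (simp add: card_gt_0_iff)
  next
    case False
    then obtain a b where ab: "edge a b \<in> F" "a \<in> V" "b \<in> V" "a \<noteq> b"
      using sub by blast
    define F0 where "F0 = F - {edge a b}"
    \<comment> \<open>\<open>k e\<close> is the coefficient of \<open>a\<close> in \<open>e\<close>.
      Adding that many copies of b - a replaces \<open>a\<close> by \<open>b\<close>, so \<phi> is
      the contraction of the edge from \<open>a\<close> to \<open>b\<close>.\<close>
    define k where "k e = poly_mapping.lookup e a" for e :: "'a \<Rightarrow>\<^sub>0 int"
    define \<phi> where "\<phi> e = e + frag_cmul (k e) (edge a b)" for e
    have key: "u e = 0" if t: "t \<subseteq> F0" and z: "(\<Sum>e\<in>t. frag_cmul (u e) (\<phi> e)) = 0" and e: "e \<in> t" for t u e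
    proof -
      have ft: "finite t" "edge a b \<notin> t"
        using t fin finite_subset unfolding F0_def by auto
      \<comment> \<open>A linear relation among contracted edges is one among edges of
        \<open>F\<close>, in which the contracted edge receives the sum \<open>c\<close> of all
        corrections.\<close>
      define c where "c = (\<Sum>e\<in>t. u e * k e)"
      define u' where "u' e = (if e = edge a b then c else u e)" for e
      have "(\<Sum>e\<in>insert (edge a b) t. frag_cmul (u' e) e) = frag_cmul c (edge a b) + (\<Sum>e\<in>t. frag_cmul (u' e) e)"
        using ft by (simp add: u'_def)
      also have "(\<Sum>e\<in>t. frag_cmul (u' e) e) = (\<Sum>e\<in>t. frag_cmul (u e) e)"
        using ft by (intro sum.cong) (auto simp: u'_def)
      also have "frag_cmul c (edge a b) = (\<Sum>e\<in>t. frag_cmul (u e * k e) (edge a b))"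
        unfolding c_def by (rule frag.scale_sum_left)
      also have "\<dots> + (\<Sum>e\<in>t. frag_cmul (u e) e) = (\<Sum>e\<in>t. frag_cmul (u e) (\<phi> e))"
        by (simp add: \<phi>_def frag_cmul_distrib2 sum.distrib add.commute)
      finally have "(\<Sum>e\<in>insert (edge a b) t. frag_cmul (u' e) e) = 0"
        using z by simp
      moreover have "insert (edge a b) t \<subseteq> F"
        using t ab F0_def by auto
      ultimately have "u' e = 0"
        using independent_sum_zeroD[OF ind, of "insert (edge a b) t" u' e] ft e by auto
      moreover have "e \<noteq> edge a b"
        using e ft by blast
      ultimately show ?thesis
        by (simp add: u'_def)
    qed
    have inj: "inj_on \<phi> F0"
    proof (rule inj_onI, rule ccontr)
      fix e e' assume *: "e \<in> F0" "e' \<in> F0" "\<phi> e = \<phi> e'" "e \<noteq> e'"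
      have "(\<Sum>x\<in>{e, e'}. frag_cmul (if x = e then 1 else -1) (\<phi> x)) = 0"
        using * by simp
      from key[OF _ this, of e] * show False
        by simp
    qed
    \<comment> \<open>A contracted edge that became a loop would be 0, a relation with a single
      term.\<close>
    have nz: "\<phi> e \<noteq> 0" if "e \<in> F0" for e
      using key[of "{e}" "\<lambda>_. 1" e] that by auto
    have img: "\<phi> e \<in> {edge v w |v w. v \<in> V - {a} \<and> w \<in> V - {a} \<and> v \<noteq> w}" if e: "e \<in> F0" for e
    proof -
      obtain x y where xy: "e = edge x y" "x \<in> V" "y \<in> V" "x \<noteq> y"
        using e sub unfolding F0_def by blast
      define \<sigma> where "\<sigma> z = (if z = a then b else z)" for z
      have "k e = (if a = y then 1 else 0) - (if a = x then 1 else 0)"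
        by (simp add: k_def xy(1) lookup_edge)
      then have eq: "\<phi> e = edge (\<sigma> x) (\<sigma> y)"
        using xy ab by (auto simp: \<phi>_def \<sigma>_def edge_def)
      then have "\<sigma> x \<noteq> \<sigma> y"
        using nz[OF e] by auto
      moreover have "\<sigma> x \<in> V - {a}" "\<sigma> y \<in> V - {a}"
        using xy ab by (auto simp: \<sigma>_def)
      ultimately show ?thesis
        using eq by blast
    qed
    have indF0: "frag.independent (\<phi> ` F0)"
      unfolding frag.dependent_explicit
    proof (clarify)
      fix t' u v
      assume t': "finite t'" "t' \<subseteq> \<phi> ` F0" "(\<Sum>v\<in>t'. frag_cmul (u v) v) = 0" and v: "v \<in> t'" "u v \<noteq> 0"
      obtain t where t: "t \<subseteq> F0" "t' = \<phi> ` t"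
        using t'(2) by (metis subset_image_iff)
      have "inj_on \<phi> t"
        using inj t inj_on_subset by blast
      then have "(\<Sum>e\<in>t. frag_cmul (u (\<phi> e)) (\<phi> e)) = 0"
        using t'(3) t(2) by (simp add: sum.reindex)
      then show False
        using key[OF t(1), of "\<lambda>e. u (\<phi> e)"] v t by auto
    qed
    have "directed_forest (V - {a}) (\<phi> ` F0)"
      using img indF0 by (auto simp: directed_forest_def)
    moreover have "card (V - {a}) < card V"
      using less.prems(1) ab(2) by (rule card_Diff1_less)
    moreover have "V - {a} \<noteq> {}"
      using ab by auto
    ultimately have "card (\<phi> ` F0) < card (V - {a})"
      using less.hyps less.prems(1) by blast
    moreover have "card (\<phi> ` F0) = card F - 1"
      using inj ab(1) fin by (simp add: card_image F0_def)
    ultimately show ?thesis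
      using ab less.prems(1) by simp
  qed
qed

section \<open>Rooted trees as parent functions\<close>

lemma trancl_cycle_forward:
  assumes "single_valued E" "(v, v) \<in> E\<^sup>+" "(v, w) \<in> E\<^sup>*"
  shows "(w, w) \<in> E\<^sup>+"
  using assms(3)
proof induction
  case base
  then show ?case
    using assms by simp
next
  case (step y z)
  obtain z' where "(y, z') \<in> E" "(z', y) \<in> E\<^sup>*"
    using step.IH tranclD by metis
  then have "(z, y) \<in> E\<^sup>*"
    using assms(1) step.hyps by (metis single_valuedD)
  then show ?case
    using step.hyps by (metis rtrancl_into_trancl1)
qed

text \<open>In a single-valued relation a path that starts on a cycle never leaves it. A cycle would
  therefore contain the root, which has no outgoing arc.\<close>

lemma parent_tree_acyclic:
  assumes "parent_tree V D E"
  shows "acyclic E"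
proof -
  have False if "(v, v) \<in> E\<^sup>+" for v
  proof -
    have "v \<in> V"
      using that assms unfolding parent_tree_def by (metis Domain.DomainI DiffD1 tranclD)
    then obtain d where d: "d \<in> D" "(v, d) \<in> E\<^sup>*"
      using assms unfolding parent_tree_def by blast
    then have "(d, d) \<in> E\<^sup>+"
      using trancl_cycle_forward that assms unfolding parent_tree_def by metis
    then have "d \<in> Domain E"
      by (metis Domain.DomainI tranclD)
    then show False
      using d assms unfolding parent_tree_def by auto
  qed
  then show ?thesis
    by (auto simp: acyclic_def)
qed

lemma acyclic_irrefl: "acyclic E \<Longrightarrow> irrefl E"
  by (auto simp: acyclic_def irrefl_def)

lemma parent_tree_irrefl: "parent_tree V D E \<Longrightarrow> irrefl E"
  by (simp add: acyclic_irrefl parent_tree_acyclic)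

lemma parent_tree_card:
  assumes "finite V" "parent_tree V {r} E"
  shows "card (case_prod edge ` E) = card V - 1"
proof -
  have irr: "irrefl E"
    using assms parent_tree_irrefl by blast
  have "inj_on (case_prod edge) E"
    using irr edge_inject by (fastforce simp: inj_on_def irrefl_def)
  moreover have "inj_on fst E"
    using assms(2) by (auto simp: parent_tree_def inj_on_def single_valued_def)
  moreover have "fst ` E = V - {r}"
    using assms(2) by (auto simp: parent_tree_def fst_eq_Domain)
  moreover have "r \<in> V"
    using assms(2) by (auto simp: parent_tree_def)
  ultimately show ?thesis
    using assms(1) by (metis card_image card_Diff_singleton)
qed

text \<open>In a linear relation between the edges, take a lowest vertex whose outgoing edge has a
  nonzero coefficient. The edges from its children have coefficient 0, so the coordinate of the sum
  at this vertex comes from the outgoing edge alone and cannot vanish.\<close>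

lemma parent_tree_forest:
  assumes "finite V" "parent_tree V D E"
  shows "directed_forest V (case_prod edge ` E)"
proof -
  have irr: "irrefl E"
    using assms parent_tree_irrefl by blast
  have sub: "E \<subseteq> V \<times> V" and sv: "single_valued E"
    using assms by (auto simp: parent_tree_def)
  have "finite E"
    using assms(1) sub finite_subset by blast
  then have wf: "wf E"
    using assms parent_tree_acyclic finite_acyclic_wf by blast
  have "frag.independent (case_prod edge ` E)"
    unfolding frag.dependent_explicit
  proof (rule notI, elim exE conjE bexE)
    fix t u e
    assume t: "finite t" "t \<subseteq> case_prod edge ` E" "(\<Sum>v\<in>t. frag_cmul (u v) v) = 0"
      and e: "e \<in> t" "u e \<noteq> 0"
    obtain x y where xy: "edge x y \<in> t" "u (edge x y) \<noteq> 0" "(x, y) \<in> E"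
      using t(2) e by auto
    define Q where "Q = {v. \<exists>w. (v, w) \<in> E \<and> edge v w \<in> t \<and> u (edge v w) \<noteq> 0}"
    have "x \<in> Q"
      using xy by (auto simp: Q_def)
    then obtain v where v: "v \<in> Q" and vmin: "\<And>z. (z, v) \<in> E \<Longrightarrow> z \<notin> Q"
      using wfE_min[OF wf] by metis
    then obtain w where w: "(v, w) \<in> E" "edge v w \<in> t" "u (edge v w) \<noteq> 0"
      by (auto simp: Q_def)
    have vw: "v \<noteq> w"
      using w irr by (auto simp: irrefl_def)
    have "0 = poly_mapping.lookup (\<Sum>e\<in>t. frag_cmul (u e) e) v"
      using t by simp
    also have "\<dots> = (\<Sum>e\<in>t. u e * poly_mapping.lookup e v)"
      by (simp add: lookup_sum lookup_frag_cmul)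
    also have "\<dots> = (\<Sum>e\<in>t. if e = edge v w then - u e else 0)"
    proof (rule sum.cong)
      fix e assume e: "e \<in> t"
      then obtain a b where ab: "e = edge a b" "(a, b) \<in> E"
        using t by auto
      have "u e = 0" if "b = v"
        using vmin[of a] ab that e by (auto simp: Q_def)
      moreover have "b = w" if "a = v"
        using sv ab w that by (auto simp: single_valued_def)
      moreover have "e = edge v w \<longleftrightarrow> a = v \<and> b = w"
        using edge_inject vw ab by metis
      ultimately show "u e * poly_mapping.lookup e v = (if e = edge v w then - u e else 0)"
        using vw by (auto simp: ab(1) lookup_edge)
    qed simp
    also have "\<dots> = - u (edge v w)"
      using w t by simp
    finally show False
      using w by simp
  qed
  moreover have "x \<in> V \<and> y \<in> V \<and> x \<noteq> y" if "(x, y) \<in> E" for x y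
    using that sub irr by (auto simp: irrefl_def)
  ultimately show ?thesis
    unfolding directed_forest_def by auto blast
qed

lemma parent_tree_rooted_tree:
  assumes "finite V" "parent_tree V {r} E"
  shows "rooted_tree V (case_prod edge ` E)"
proof -
  let ?T = "case_prod edge ` E"
  have r: "r \<in> V" "Domain E = V - {r}" "\<And>v. v \<in> V \<Longrightarrow> (v, r) \<in> E\<^sup>*"
    using assms by (auto simp: parent_tree_def)
  have le: "tree_le ?T v w \<longleftrightarrow> (v, w) \<in> E\<^sup>*" for v w
    using parent_tree_irrefl[OF assms(2)] by (simp add: tree_le_iff arcs_edge_image)
  have "directed_tree V ?T"
    unfolding directed_tree_def
  proof (intro conjI allI impI)
    \<comment> \<open>The bound \<open>directed_forest_card\<close> is attained, with one edge for
      each vertex other than \<open>r\<close>.\<close>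
    show "card F \<le> card ?T" if "directed_forest V F" for F
      using directed_forest_card[OF assms(1) _ that] r parent_tree_card[OF assms] by fastforce
  qed (rule parent_tree_forest[OF assms])
  moreover have "\<exists>!r. r \<in> V \<and> \<not> (\<exists>w\<in>V. tree_less ?T r w)"
  proof (rule ex1I[of _ r])
    show "r \<in> V \<and> \<not> (\<exists>w\<in>V. tree_less ?T r w)"
    proof -
      have "r = w" if "(r, w) \<in> E\<^sup>*" for w
        using that r(2) by (cases rule: converse_rtranclE) auto
      then show ?thesis
        using r(1) by (auto simp: tree_less_def le)
    qed
    show "v = r" if "v \<in> V \<and> \<not> (\<exists>w\<in>V. tree_less ?T v w)" for v
      using that r by (auto simp: tree_less_def le)
  qed
  ultimately show ?thesis
    by (simp add: rooted_tree_def)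
qed

text \<open>Since the maximal vertex is unique, every other vertex has an outgoing edge, which
  already makes \<open>card V - 1\<close> edges. Independence permits no more, so these are all the
  edges and each vertex has one parent.\<close>

lemma rooted_tree_parent_tree:
  assumes "finite V" "rooted_tree V T"
  obtains r where "parent_tree V {r} (arcs T)" "case_prod edge ` arcs T = T"
proof -
  obtain r where r: "r \<in> V" "\<And>w. w \<in> V \<Longrightarrow> \<not> tree_less T r w"
    and uniq: "\<And>v. v \<in> V \<Longrightarrow> \<not> (\<exists>w\<in>V. tree_less T v w) \<Longrightarrow> v = r"
    using assms(2) unfolding rooted_tree_def by blast
  have forest: "directed_forest V T"
    using assms(2) by (simp add: rooted_tree_def directed_tree_def)
  then have sub: "T \<subseteq> {edge v w |v w. v \<in> V \<and> w \<in> V \<and> v \<noteq> w}" and ind: "frag.independent T"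
    by (auto simp: directed_forest_def)
  have fin: "finite T"
    using directed_forest_finite[OF assms(1) forest] .
  have T: "case_prod edge ` arcs T = T"
    using edge_image_arcs[OF sub] .
  have "0 \<notin> T"
    using sub by auto
  then have irr: "irrefl (arcs T)"
    by (auto simp: arcs_def irrefl_def)
  have arcs_V: "v \<in> V \<and> w \<in> V" if "(v, w) \<in> arcs T" for v w
  proof -
    have "v \<noteq> w" "edge v w \<in> T"
      using that irr by (auto simp: arcs_def irrefl_def)
    then show ?thesis
      using sub edge_inject[of v w] by blast
  qed
  have no_out: "(r, w) \<notin> arcs T" for w
    using r(2)[of w] arcs_V[of r w] irr by (auto simp: tree_less_def tree_le_iff irrefl_def)
  have out: "\<exists>w. (v, w) \<in> arcs T" if "v \<in> V" "v \<noteq> r" for v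
  proof -
    have "\<exists>w\<in>V. tree_less T v w"
      using uniq that by metis
    then obtain w where "(v, w) \<in> (arcs T)\<^sup>*" "v \<noteq> w"
      by (auto simp: tree_less_def tree_le_iff)
    then show ?thesis
      by (cases rule: converse_rtranclE) auto
  qed
  then obtain p where p: "\<And>v. v \<in> V - {r} \<Longrightarrow> (v, p v) \<in> arcs T"
    by (metis DiffE singletonI)
  let ?q = "\<lambda>v. edge v (p v)"
  have pne: "v \<noteq> p v" if "v \<in> V - {r}" for v
    using p[OF that] irr by (metis irreflD)
  have inj: "inj_on ?q (V - {r})"
    using edge_inject pne by (meson inj_onI)
  have qT: "?q ` (V - {r}) \<subseteq> T"
    using p by (auto simp: arcs_def)
  moreover have "card T \<le> card (?q ` (V - {r}))"
    using directed_forest_card[OF assms(1) _ forest] r inj assms(1) by (fastforce simp: card_image)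
  ultimately have eq: "?q ` (V - {r}) = T"
    using card_seteq[OF fin] by blast
  have pw: "w = p v" if "(v, w) \<in> arcs T" for v w
  proof -
    have "edge v w \<in> ?q ` (V - {r})"
      using that eq by (auto simp: arcs_def)
    moreover have "v \<noteq> w"
      using that irr by (auto simp: irrefl_def)
    ultimately show ?thesis
      using edge_inject[of v w] by blast
  qed
  have reach: "(v, r) \<in> (arcs T)\<^sup>*" if "v \<in> V" for v
  proof (rule ccontr)
    assume "(v, r) \<notin> (arcs T)\<^sup>*"
    \<comment> \<open>Parents of vertices in \<open>U\<close> stay in \<open>U\<close>. So
      \<open>U\<close> would carry as many independent edges as it has vertices, against
      \<open>directed_forest_card\<close>.\<close>
    define U where "U = {v \<in> V. (v, r) \<notin> (arcs T)\<^sup>*}"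
    have U: "U \<noteq> {}" "U \<subseteq> V - {r}" "finite U"
      using \<open>(v, r) \<notin> (arcs T)\<^sup>*\<close> that assms(1) by (auto simp: U_def)
    have "p u \<in> U" if "u \<in> U" for u
    proof -
      have "(u, p u) \<in> arcs T"
        using that U p by blast
      then show ?thesis
        using that arcs_V by (auto simp: U_def intro: converse_rtrancl_into_rtrancl)
    qed
    then have "directed_forest U (?q ` U)"
      unfolding directed_forest_def using pne U qT frag.independent_mono[OF ind, of "?q ` U"] by blast
    then have "card (?q ` U) < card U"
      using directed_forest_card U by blast
    moreover have "card (?q ` U) = card U"
      using card_image inj_on_subset[OF inj U(2)] by blast
    ultimately show False
      by simp
  qed
  have "parent_tree V {r} (arcs T)"
    unfolding parent_tree_def
  proof (intro conjI)
    show "single_valued (arcs T)"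
      using pw by (metis single_valuedI)
    show "Domain (arcs T) = V - {r}"
      using arcs_V no_out out by fastforce
  qed (use r arcs_V reach in auto)
  then show ?thesis
    using that T by blast
qed

text \<open>Both domains omit exactly one vertex, so their inclusion is an equality, and a
  single-valued relation has no room for a second arc at any vertex.\<close>

lemma parent_tree_subset_eq:
  assumes "parent_tree V {r} E" "parent_tree V {s} F" "E \<subseteq> F"
  shows "E = F"
proof -
  have E: "Domain E = V - {r}" "r \<in> V" and F: "Domain F = V - {s}" "s \<in> V" "single_valued F"
    using assms(1,2) by (auto simp: parent_tree_def)
  have "V - {r} \<subseteq> V - {s}"
    using Domain_mono[OF assms(3)] E F by simp
  then have eq: "Domain E = Domain F"
    using E F by auto
  have "(v, w) \<in> E" if vw: "(v, w) \<in> F" for v w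
  proof -
    obtain w' where "(v, w') \<in> E"
      using vw eq by (metis Domain.cases DomainI)
    then show ?thesis
      using F(3) vw assms(3) by (metis single_valuedD subsetD)
  qed
  then show ?thesis
    using assms(3) by auto
qed

section \<open>Binary trees on a totally ordered set\<close>

text \<open>Relative to a carrier, because \<open>left_of\<close> is a total order on each parallel
  set but not on all parts.\<close>

definition strict_total_on :: "'b set \<Rightarrow> ('b \<Rightarrow> 'b \<Rightarrow> bool) \<Rightarrow> bool" where
  "strict_total_on P lt \<longleftrightarrow> irreflp_on P lt \<and> transp_on P lt \<and> totalp_on P lt"

lemma strict_total_on_subset: "strict_total_on P lt \<Longrightarrow> Q \<subseteq> P \<Longrightarrow> strict_total_on Q lt"
  unfolding strict_total_on_def
  by (metis irreflp_on_subset transp_on_subset totalp_on_subset)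

lemma strict_total_on_irrefl: "strict_total_on P lt \<Longrightarrow> x \<in> P \<Longrightarrow> \<not> lt x x"
  and strict_total_on_trans:
    "strict_total_on P lt \<Longrightarrow> x \<in> P \<Longrightarrow> y \<in> P \<Longrightarrow> z \<in> P \<Longrightarrow> lt x y \<Longrightarrow> lt y z \<Longrightarrow> lt x z"
  and strict_total_on_total: "strict_total_on P lt \<Longrightarrow> x \<in> P \<Longrightarrow> y \<in> P \<Longrightarrow> x \<noteq> y \<Longrightarrow> lt x y \<or> lt y x"
  unfolding strict_total_on_def irreflp_on_def transp_on_def totalp_on_def by blast+

lemma strict_total_on_asym: "strict_total_on P lt \<Longrightarrow> x \<in> P \<Longrightarrow> y \<in> P \<Longrightarrow> lt x y \<Longrightarrow> \<not> lt y x"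
  using strict_total_on_irrefl strict_total_on_trans by metis

lemma strict_total_on_least:
  assumes "strict_total_on P lt" "finite A" "A \<noteq> {}" "A \<subseteq> P"
  shows "\<exists>m\<in>A. \<forall>x\<in>A. x \<noteq> m \<longrightarrow> lt m x"
  using assms(2-4)
proof (induction rule: finite_ne_induct)
  case (insert a A)
  then obtain m where m: "m \<in> A" "\<forall>x\<in>A. x \<noteq> m \<longrightarrow> lt m x"
    by auto
  have "a \<noteq> m" "a \<in> P" "m \<in> P"
    using insert m by auto
  then consider "lt a m" | "lt m a"
    using strict_total_on_total[OF assms(1)] by blast
  then show ?case
  proof cases
    case 1
    have "lt a x" if "x \<in> A" for x
      using 1 m that insert.prems strict_total_on_trans[OF assms(1), of a m x] by (cases "x = m") auto
    then show ?thesis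
      by auto
  next
    case 2
    then show ?thesis
      using m by auto
  qed
qed simp

lemma strict_total_on_converse: "strict_total_on P lt \<Longrightarrow> strict_total_on P (\<lambda>x y. lt y x)"
  unfolding strict_total_on_def irreflp_on_def transp_on_def totalp_on_def by blast

text \<open>Conditions (i) and (iii) for parent relations. As a parent relation is acyclic, its
  transitive closure is the strict tree order.\<close>

definition binary_parent_tree :: "('b \<Rightarrow> 'b \<Rightarrow> bool) \<Rightarrow> 'b set \<Rightarrow> 'b set \<Rightarrow> ('b \<times> 'b) set \<Rightarrow> bool" where
  "binary_parent_tree lt P D E \<longleftrightarrow> parent_tree P D E \<and>
     (\<forall>x y z. (x, y) \<in> E \<longrightarrow> z \<in> P \<longrightarrow> strictly_between lt x z y \<longrightarrow> (z, x) \<in> E\<^sup>+) \<and>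
     (\<forall>x y z. (y, x) \<in> E \<longrightarrow> (z, x) \<in> E \<longrightarrow> y \<noteq> z \<longrightarrow> strictly_between lt y x z)"

lemma binary_parent_tree_binary_tree:
  assumes fin: "finite P" and ord: "strict_total_on P lt" and bt: "binary_parent_tree lt P {r} E"
  shows "binary_tree lt P (case_prod edge ` E)"
proof -
  let ?T = "case_prod edge ` E"
  have pt: "parent_tree P {r} E"
    using bt by (simp add: binary_parent_tree_def)
  have arcs: "arcs ?T = E"
    using arcs_edge_image parent_tree_irrefl pt by blast
  have edge_in: "edge x y \<in> ?T \<longleftrightarrow> (x, y) \<in> E" for x y
    using arcs unfolding arcs_def by blast
  have sub: "E \<subseteq> P \<times> P"
    using pt by (simp add: parent_tree_def)
  have children: "children P ?T x = {y. (y, x) \<in> E}" for x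
    using sub by (auto simp: children_def edge_in)
  have sep: "strictly_between lt y x z" if "(y, x) \<in> E" "(z, x) \<in> E" "y \<noteq> z" for x y z
    using bt that unfolding binary_parent_tree_def by blast
  \<comment> \<open>Condition (ii) follows from (iii): of three children, two lie on the same side
    of \<open>x\<close>, which then does not separate them.\<close>
  have two: "card {y. (y, x) \<in> E} \<le> 2" if x: "x \<in> P" for x
  proof (rule ccontr)
    assume "\<not> card {y. (y, x) \<in> E} \<le> 2"
    then have "3 \<le> card {y. (y, x) \<in> E}"
      by simp
    then obtain C where "C \<subseteq> {y. (y, x) \<in> E}" "card C = 3"
      by (metis obtain_subset_with_card_n)
    then obtain a b c where abc: "(a, x) \<in> E" "(b, x) \<in> E" "(c, x) \<in> E" "a \<noteq> b" "b \<noteq> c" "a \<noteq> c"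
      by (auto simp: card_3_iff)
    then have "a \<in> P" "b \<in> P" "c \<in> P"
      using sub by auto
    then have "\<not> (lt v x \<and> lt x v)" if "v \<in> {a, b, c}" for v
      using strict_total_on_trans[OF ord] strict_total_on_irrefl[OF ord] x that by blast
    then show False
      using sep[OF abc(1,2,4)] sep[OF abc(2,3,5)] sep[OF abc(1,3,6)]
      unfolding strictly_between_def by blast
  qed
  have "tree_less ?T z x" if "(z, x) \<in> E\<^sup>+" for z x
    using that parent_tree_acyclic[OF pt]
    by (auto simp: tree_less_def tree_le_iff arcs acyclic_def)
  then show ?thesis
    using parent_tree_rooted_tree[OF fin pt] sep two bt
    unfolding binary_tree_def children edge_in binary_parent_tree_def by blast
qed

text \<open>Two arcs can occur in a common binary tree iff they satisfy this condition in both orders.\<close>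

definition arc_compat :: "('b \<Rightarrow> 'b \<Rightarrow> bool) \<Rightarrow> 'b \<times> 'b \<Rightarrow> 'b \<times> 'b \<Rightarrow> bool" where
  "arc_compat lt = (\<lambda>(x, y) (u, v).
     (x = u \<longrightarrow> y = v) \<and> \<not> (x = v \<and> y = u) \<and>
     (strictly_between lt x u y \<longrightarrow> strictly_between lt x v y \<or> v = x) \<and>
     (strictly_between lt x v y \<longrightarrow> strictly_between lt x u y))"

text \<open>This is what an arc demands of the root of a binary tree containing it: the root has no
  parent, and by condition (i) a vertex under an arc is strictly below the tail.\<close>

definition root_compat :: "('b \<Rightarrow> 'b \<Rightarrow> bool) \<Rightarrow> 'b \<Rightarrow> 'b \<times> 'b \<Rightarrow> bool" where
  "root_compat lt r = (\<lambda>(x, y). x \<noteq> r \<and> \<not> strictly_between lt x r y)"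

section \<open>Betweenness and the arcs of a binary tree\<close>

lemma strictly_between_commute: "strictly_between lt x z y \<longleftrightarrow> strictly_between lt y z x"
  unfolding strictly_between_def by blast

lemma strictly_between_cases:
  assumes "strict_total_on P lt" "x \<in> P" "y \<in> P" "z \<in> P" "x \<noteq> y" "y \<noteq> z" "x \<noteq> z"
  shows "strictly_between lt x y z \<or> strictly_between lt y z x \<or> strictly_between lt z x y"
  using assms strict_total_on_total[OF assms(1)] unfolding strictly_between_def by metis

lemma strictly_between_outside:
  assumes ord: "strict_total_on P lt" and P: "x \<in> P" "y \<in> P" "u \<in> P" "v \<in> P"
    and u: "strictly_between lt x u y" and v: "\<not> strictly_between lt x v y" and "v \<noteq> x" "v \<noteq> y"
  shows "strictly_between lt u x v \<or> strictly_between lt u y v"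
proof -
  note tot = strict_total_on_total[OF ord]
  have "lt v x \<or> lt x v" "lt v y \<or> lt y v"
    using tot assms by metis+
  then show ?thesis
    using u v unfolding strictly_between_def by blast
qed

lemma trancl_parent:
  assumes "single_valued E" "(u, v) \<in> E" "(u, x) \<in> E\<^sup>+"
  shows "(v, x) \<in> E\<^sup>*"
  using assms by (metis single_valuedD tranclD)

text \<open>If exactly one end of the arc (u, v) lies under (x, y), and \<open>v\<close> is not
  \<open>x\<close>, then \<open>u\<close> is strictly below \<open>x\<close>: either it lies under
  (x, y) itself, or its parent does. The arc (u, v) then passes over \<open>x\<close> or
  \<open>y\<close>, which puts \<open>x\<close> or \<open>y\<close> below \<open>u\<close> and
  closes a cycle. The end outside cannot be \<open>y\<close>, since \<open>y\<close> is not below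
  \<open>x\<close>.\<close>

lemma binary_tree_compat:
  assumes fin: "finite P" and ord: "strict_total_on P lt" and T: "binary_tree lt P T"
  obtains r where "parent_tree P {r} (arcs T)" "case_prod edge ` arcs T = T"
    "\<And>e f. e \<in> arcs T \<Longrightarrow> f \<in> arcs T \<Longrightarrow> arc_compat lt e f"
    "\<And>e. e \<in> arcs T \<Longrightarrow> root_compat lt r e"
proof -
  obtain r where pt: "parent_tree P {r} (arcs T)" and im: "case_prod edge ` arcs T = T"
    using rooted_tree_parent_tree fin T unfolding binary_tree_def by blast
  let ?E = "arcs T"
  have sub: "?E \<subseteq> P \<times> P" and sv: "single_valued ?E" and dom: "Domain ?E = P - {r}" and r: "r \<in> P"
    using pt by (auto simp: parent_tree_def)
  have acyc: "(x, x) \<notin> ?E\<^sup>+" for x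
    using parent_tree_acyclic[OF pt] by (auto simp: acyclic_def)
  have below: "(z, x) \<in> ?E\<^sup>+" if "(x, y) \<in> ?E" "z \<in> P" "strictly_between lt x z y" for x y z
  proof -
    have "x \<in> P" "y \<in> P"
      using that sub by auto
    then have "tree_less T z x"
      using T that unfolding binary_tree_def arcs_def by blast
    then show ?thesis
      by (auto simp: tree_less_def tree_le_iff rtrancl_eq_or_trancl)
  qed
  have "arc_compat lt (x, y) (u, v)" if xy: "(x, y) \<in> ?E" and uv: "(u, v) \<in> ?E" for x y u v
  proof -
    have P: "x \<in> P" "y \<in> P" "u \<in> P" "v \<in> P"
      using sub xy uv by auto
    have up: "(y, x) \<notin> ?E\<^sup>*"
      using acyc[of x] xy by (meson rtrancl_into_trancl2)
    have a: "x = u \<longrightarrow> y = v"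
      using sv xy uv by (metis single_valuedD)
    have b: "\<not> (x = v \<and> y = u)"
      using up uv by blast
    have c: "strictly_between lt x v y \<or> v = x" if btw: "strictly_between lt x u y"
    proof (rule ccontr)
      assume n: "\<not> (strictly_between lt x v y \<or> v = x)"
      have ux: "(u, x) \<in> ?E\<^sup>+"
        using below xy P btw by blast
      then have vx: "(v, x) \<in> ?E\<^sup>*"
        using trancl_parent sv uv by metis
      then have "v \<noteq> y"
        using up by blast
      then consider "strictly_between lt u x v" | "strictly_between lt u y v"
        using strictly_between_outside[OF ord P btw] n by blast
      then show False
      proof cases
        case 1
        then have "(x, u) \<in> ?E\<^sup>+"
          using below uv P by blast
        then show False
          using ux acyc by (meson trancl_trans)
      next
        case 2
        then have "(y, u) \<in> ?E\<^sup>+"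
          using below uv P by blast
        then show False
          using ux up by (meson trancl_trans trancl_into_rtrancl)
      qed
    qed
    have d: "strictly_between lt x u y" if btw: "strictly_between lt x v y"
    proof (rule ccontr)
      assume n: "\<not> strictly_between lt x u y"
      have ux: "(u, x) \<in> ?E\<^sup>+"
        using below xy P btw uv by (meson trancl_into_trancl2)
      then have "u \<noteq> x" "u \<noteq> y"
        using acyc up by (auto dest: trancl_into_rtrancl)
      then consider "strictly_between lt v x u" | "strictly_between lt v y u"
        using strictly_between_outside[OF ord P(1,2,4,3) btw n] by blast
      then show False
      proof cases
        case 1
        then have "(x, u) \<in> ?E\<^sup>+"
          using below uv P by (metis strictly_between_commute)
        then show False
          using ux acyc by (meson trancl_trans)
      next
        case 2
        then have "(y, u) \<in> ?E\<^sup>+"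
          using below uv P by (metis strictly_between_commute)
        then show False
          using ux up by (meson trancl_trans trancl_into_rtrancl)
      qed
    qed
    show ?thesis
      using a b c d unfolding arc_compat_def by blast
  qed
  moreover have "root_compat lt r (x, y)" if xy: "(x, y) \<in> ?E" for x y
  proof -
    have "(r, x) \<notin> ?E\<^sup>+"
      using dom by (metis Diff_iff Domain.DomainI singletonI tranclD)
    then have "\<not> strictly_between lt x r y"
      using below xy r by blast
    moreover have "x \<noteq> r"
      using xy dom by blast
    ultimately show ?thesis
      by (simp add: root_compat_def)
  qed
  ultimately show ?thesis
    using that pt im by force
qed

text \<open>Whatever lies between two vertices of one side, or between such a vertex and
  \<open>r\<close>, belongs to that side. So condition (i) is inherited by the old arcs, and it
  holds for a new arc into \<open>r\<close> because its tail is above its whole side. As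
  \<open>DL\<close> and \<open>DR\<close> have at most one element each, \<open>r\<close> gets at
  most one child per side.\<close>

lemma binary_parent_tree_join:
  assumes ord: "strict_total_on P lt" and r: "r \<in> P"
    and L: "L = {p \<in> P. lt p r}" and R: "R = {p \<in> P. lt r p}"
    and btL: "binary_parent_tree lt L DL EL" and btR: "binary_parent_tree lt R DR ER"
  shows "binary_parent_tree lt P {r} (EL \<union> ER \<union> (DL \<union> DR) \<times> {r})"
proof -
  let ?E = "EL \<union> ER \<union> (DL \<union> DR) \<times> {r}"
  note irrefl = strict_total_on_irrefl[OF ord] and trans = strict_total_on_trans[OF ord]
    and asym = strict_total_on_asym[OF ord]
  have nLR: "v \<notin> R" if "v \<in> L" for v
    using that asym[of v r] r unfolding L R by blast
  have rLR: "r \<notin> L" "r \<notin> R"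
    using irrefl r unfolding L R by auto
  have P: "P = insert r (L \<union> R)"
    using strict_total_on_total[OF ord] r unfolding L R by blast
  have ptL: "parent_tree L DL EL" and ptR: "parent_tree R DR ER"
    using btL btR by (auto simp: binary_parent_tree_def)
  have DL: "DL \<subseteq> L" and EL: "EL \<subseteq> L \<times> L" and domL: "Domain EL = L - DL" and svL: "single_valued EL"
    and oneL: "\<And>c d. c \<in> DL \<Longrightarrow> d \<in> DL \<Longrightarrow> c = d" and reachL: "\<And>v. v \<in> L \<Longrightarrow> \<exists>d\<in>DL. (v, d) \<in> EL\<^sup>*"
    using ptL by (auto simp: parent_tree_def)
  have DR: "DR \<subseteq> R" and ER: "ER \<subseteq> R \<times> R" and domR: "Domain ER = R - DR" and svR: "single_valued ER"
    and oneR: "\<And>c d. c \<in> DR \<Longrightarrow> d \<in> DR \<Longrightarrow> c = d" and reachR: "\<And>v. v \<in> R \<Longrightarrow> \<exists>d\<in>DR. (v, d) \<in> ER\<^sup>*"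
    using ptR by (auto simp: parent_tree_def)
  have belowL: "(z, x) \<in> EL\<^sup>+" if "(x, y) \<in> EL" "z \<in> L" "strictly_between lt x z y" for x y z
    using btL that unfolding binary_parent_tree_def by blast
  have belowR: "(z, x) \<in> ER\<^sup>+" if "(x, y) \<in> ER" "z \<in> R" "strictly_between lt x z y" for x y z
    using btR that unfolding binary_parent_tree_def by blast
  have sepL: "strictly_between lt y x z" if "(y, x) \<in> EL" "(z, x) \<in> EL" "y \<noteq> z" for x y z
    using btL that unfolding binary_parent_tree_def by blast
  have sepR: "strictly_between lt y x z" if "(y, x) \<in> ER" "(z, x) \<in> ER" "y \<noteq> z" for x y z
    using btR that unfolding binary_parent_tree_def by blast
  have toL: "z \<in> L" if "z \<in> P" "x \<in> L" "y \<in> insert r L" "strictly_between lt x z y" for x y z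
    using that trans[of z x r] trans[of z y r] r unfolding L strictly_between_def by blast
  have toR: "z \<in> R" if "z \<in> P" "x \<in> R" "y \<in> insert r R" "strictly_between lt x z y" for x y z
    using that trans[of r x z] trans[of r y z] r unfolding R strictly_between_def by blast
  have rootL: "(z, d) \<in> EL\<^sup>+" if "d \<in> DL" "z \<in> L" "z \<noteq> d" for z d
    using reachL[OF that(2)] oneL that by (metis rtrancl_eq_or_trancl)
  have rootR: "(z, d) \<in> ER\<^sup>+" if "d \<in> DR" "z \<in> R" "z \<noteq> d" for z d
    using reachR[OF that(2)] oneR that by (metis rtrancl_eq_or_trancl)
  have neq: "z \<noteq> x" if "z \<in> P" "strictly_between lt x z y" for x y z
    using that irrefl unfolding strictly_between_def by blast
  have monoL: "EL\<^sup>* \<subseteq> ?E\<^sup>*" "EL\<^sup>+ \<subseteq> ?E\<^sup>+" and monoR: "ER\<^sup>* \<subseteq> ?E\<^sup>*" "ER\<^sup>+ \<subseteq> ?E\<^sup>+"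
    by (intro rtrancl_mono trancl_mono_subset; blast)+
  have "single_valued ?E"
  proof (rule single_valuedI)
    fix x y z assume *: "(x, y) \<in> ?E" "(x, z) \<in> ?E"
    have "x \<notin> DL" "x \<in> L" if "(x, w) \<in> EL" for w
      using that domL by blast+
    moreover have "x \<notin> DR" "x \<in> R" if "(x, w) \<in> ER" for w
      using that domR by blast+
    ultimately show "y = z"
      using * nLR[of x] DL DR svL svR unfolding single_valued_def by blast
  qed
  moreover have "Domain ?E = P - {r}"
  proof -
    have "Domain ?E = Domain EL \<union> Domain ER \<union> (DL \<union> DR)"
      by auto
    then show ?thesis
      using domL domR DL DR P rLR by auto
  qed
  moreover have "(v, r) \<in> ?E\<^sup>*" if v: "v \<in> P" for v
  proof -
    consider "v = r" | "v \<in> L" | "v \<in> R"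
      using v P by blast
    then show ?thesis
    proof cases
      case 2
      then obtain d where "d \<in> DL" "(v, d) \<in> EL\<^sup>*"
        using reachL by blast
      then have "(v, d) \<in> ?E\<^sup>*" "(d, r) \<in> ?E"
        using monoL by auto
      then show ?thesis
        by (rule rtrancl_into_rtrancl)
    next
      case 3
      then obtain d where "d \<in> DR" "(v, d) \<in> ER\<^sup>*"
        using reachR by blast
      then have "(v, d) \<in> ?E\<^sup>*" "(d, r) \<in> ?E"
        using monoR by auto
      then show ?thesis
        by (rule rtrancl_into_rtrancl)
    qed simp
  qed
  moreover have "?E \<subseteq> P \<times> P"
    using EL ER DL DR P by blast
  ultimately have "parent_tree P {r} ?E"
    using r unfolding parent_tree_def by blast
  moreover have "(z, x) \<in> ?E\<^sup>+" if xy: "(x, y) \<in> ?E" and z: "z \<in> P" "strictly_between lt x z y" for x y z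
  proof -
    consider "(x, y) \<in> EL" | "(x, y) \<in> ER" | "x \<in> DL" "y = r" | "x \<in> DR" "y = r"
      using xy by blast
    then show ?thesis
    proof cases
      case 1
      then have "z \<in> L"
        using toL z EL by blast
      then show ?thesis
        using belowL 1 z monoL by blast
    next
      case 2
      then have "z \<in> R"
        using toR z ER by blast
      then show ?thesis
        using belowR 2 z monoR by blast
    next
      case 3
      then have "z \<in> L"
        using toL z DL by blast
      then show ?thesis
        using rootL 3 z monoL neq by blast
    next
      case 4
      then have "z \<in> R"
        using toR z DR by blast
      then show ?thesis
        using rootR 4 z monoR neq by blast
    qed
  qed
  moreover have "strictly_between lt y x z" if yx: "(y, x) \<in> ?E" and zx: "(z, x) \<in> ?E" and yz: "y \<noteq> z" for x y z
  proof (cases "x = r")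
    case True
    then have "y \<in> DL \<union> DR" "z \<in> DL \<union> DR"
      using yx zx EL ER rLR by auto
    then have "(y \<in> L \<and> z \<in> R) \<or> (y \<in> R \<and> z \<in> L)"
      using oneL oneR yz DL DR by blast
    then show ?thesis
      using True unfolding L R strictly_between_def by blast
  next
    case False
    then have "(y, x) \<in> EL \<union> ER" "(z, x) \<in> EL \<union> ER"
      using yx zx by auto
    then show ?thesis
      using sepL sepR yz nLR EL ER by blast
  qed
  ultimately show ?thesis
    unfolding binary_parent_tree_def by blast
qed

text \<open>An outermost vertex without an arc to the right exists; the leftmost one has no arc to the
  left either, so it can serve as the root.\<close>

lemma arc_compat_root_exists:
  assumes fin: "finite P" and ord: "strict_total_on P lt" and ne: "P \<noteq> {}"
    and X: "X \<subseteq> P \<times> P" "irrefl X" "\<And>e f. e \<in> X \<Longrightarrow> f \<in> X \<Longrightarrow> arc_compat lt e f"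
  obtains r where "r \<in> P" "\<And>e. e \<in> X \<Longrightarrow> root_compat lt r e"
proof -
  note irrefl = strict_total_on_irrefl[OF ord] and asym = strict_total_on_asym[OF ord]
    and tot = strict_total_on_total[OF ord]
  define outer where "outer q \<longleftrightarrow> (\<forall>(x, y)\<in>X. \<not> strictly_between lt x q y)" for q
  define A where "A = {q \<in> P. outer q \<and> (\<forall>y. (q, y) \<in> X \<longrightarrow> \<not> lt q y)}"
  obtain m where m: "m \<in> P" "\<forall>x\<in>P. x \<noteq> m \<longrightarrow> lt x m"
    using strict_total_on_least[OF strict_total_on_converse[OF ord] fin ne] by blast
  have not_above: "\<not> lt m x" if "x \<in> P" for x
    using m(2) that asym[OF m(1) that] irrefl[OF m(1)] by metis
  have "m \<in> A"
  proof -
    have "\<not> strictly_between lt x m y" if "(x, y) \<in> X" for x y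
      using that X(1) not_above unfolding strictly_between_def by blast
    moreover have "\<not> lt m y" if "(m, y) \<in> X" for y
      using that X(1) not_above by blast
    ultimately show ?thesis
      using m(1) unfolding A_def outer_def by blast
  qed
  then obtain r where r: "r \<in> A" "\<forall>x\<in>A. x \<noteq> r \<longrightarrow> lt r x"
    using strict_total_on_least[OF ord, of A] fin unfolding A_def by auto
  have rP: "r \<in> P" and router: "outer r"
    using r by (auto simp: A_def)
  \<comment> \<open>An arc from \<open>r\<close> would go left, to some \<open>v\<close>. Since
    \<open>r\<close> lies under no arc, neither does \<open>v\<close>; as \<open>r\<close> is the
    leftmost candidate, \<open>v\<close> must have an arc to some \<open>w\<close> on its right. If
    w = r this is a two-cycle; if \<open>w\<close> lies before \<open>r\<close>, the arc (v, w) ends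
    under (r, v) without starting there; if \<open>w\<close> lies beyond \<open>r\<close>, then
    \<open>r\<close> is under (v, w).\<close>
  have sink: "(r, v) \<notin> X" for v
  proof
    assume rv: "(r, v) \<in> X"
    have v: "v \<in> P" "v \<noteq> r"
      using X rv by (auto simp: irrefl_def)
    have vr: "lt v r"
      using tot[OF v(1) rP v(2)] r(1) rv unfolding A_def by blast
    have "outer v"
      unfolding outer_def
    proof clarify
      fix x y assume "(x, y) \<in> X" "strictly_between lt x v y"
      then have "strictly_between lt x r y"
        using X(3)[of "(x, y)" "(r, v)"] rv unfolding arc_compat_def by auto
      then show False
        using router \<open>(x, y) \<in> X\<close> unfolding outer_def by blast
    qed
    moreover have "v \<notin> A"
      using r(2) v vr asym[OF v(1) rP] by blast
    ultimately obtain w where vw: "(v, w) \<in> X" "lt v w"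
      using v unfolding A_def by blast
    have w: "w \<in> P"
      using vw X by blast
    have "w \<noteq> r"
      using X(3)[of "(r, v)" "(v, w)"] rv vw unfolding arc_compat_def by auto
    then consider "lt w r" | "lt r w"
      using tot w rP by blast
    then show False
    proof cases
      case 1
      then have "strictly_between lt r w v"
        using vw unfolding strictly_between_def by blast
      then have "strictly_between lt r v v"
        using X(3)[of "(r, v)" "(v, w)"] rv vw unfolding arc_compat_def by auto
      then show False
        using irrefl v unfolding strictly_between_def by blast
    next
      case 2
      then have "strictly_between lt v r w"
        using vr unfolding strictly_between_def by blast
      then show False
        using router vw unfolding outer_def by blast
    qed
  qed
  have "root_compat lt r e" if "e \<in> X" for e
    using that sink router unfolding outer_def root_compat_def by auto
  then show ?thesis
    using that rP by blast
qed

text \<open>The prescribed root \<open>D\<close> is what carries the induction: splitting at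
  \<open>r\<close> turns an arc (c, r) of \<open>X\<close> into the demand that \<open>c\<close> be
  the root of its side.\<close>

lemma arc_compat_extend:
  assumes "finite P" "strict_total_on P lt"
    and "X \<subseteq> P \<times> P" "irrefl X" "\<And>e f. e \<in> X \<Longrightarrow> f \<in> X \<Longrightarrow> arc_compat lt e f"
    and "D \<subseteq> P" "\<And>c d. c \<in> D \<Longrightarrow> d \<in> D \<Longrightarrow> c = d"
    and "\<And>d e. d \<in> D \<Longrightarrow> e \<in> X \<Longrightarrow> root_compat lt d e"
  shows "\<exists>D' E. binary_parent_tree lt P D' E \<and> X \<subseteq> E \<and> D \<subseteq> D'"
  using assms
proof (induction "card P" arbitrary: P X D rule: less_induct)
  case less
  note fin = less.prems(1) and ord = less.prems(2) and X = less.prems(3-5) and D = less.prems(6-8)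
  note irrefl = strict_total_on_irrefl[OF ord] and asym = strict_total_on_asym[OF ord]
    and tot = strict_total_on_total[OF ord]
  show ?case
  proof (cases "P = {}")
    case True
    then have "binary_parent_tree lt P {} {}" "X = {}" "D = {}"
      using X D by (auto simp: binary_parent_tree_def parent_tree_def)
    then show ?thesis
      by blast
  next
    case False
    obtain r where r: "r \<in> P" and rX: "\<And>e. e \<in> X \<Longrightarrow> root_compat lt r e" and rD: "D \<subseteq> {r}"
    proof (cases "D = {}")
      case True
      then show ?thesis
        using arc_compat_root_exists[OF fin ord False X] that by (metis empty_subsetI)
    next
      case False
      then obtain d where "d \<in> D"
        by blast
      then show ?thesis
        using that[of d] D by blast
    qed
    \<comment> \<open>Treats both sides at once: what matters about \<open>Q\<close> is that it
      avoids \<open>r\<close> and that \<open>r\<close> separates no two of its vertices.\<close>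
    have side: "\<exists>D' E. binary_parent_tree lt Q D' E \<and> X \<inter> Q \<times> Q \<subseteq> E \<and> {c \<in> Q. (c, r) \<in> X} \<subseteq> D'"
      if Q: "Q \<subseteq> P" "r \<notin> Q" and out: "\<And>u v. u \<in> Q \<Longrightarrow> v \<in> Q \<Longrightarrow> \<not> strictly_between lt u r v" for Q
    proof (rule less.hyps)
      show "card Q < card P"
        using Q r by (intro psubset_card_mono[OF fin]) blast
      show "finite Q"
        using Q(1) fin by (rule finite_subset)
      show "strict_total_on Q lt"
        using ord Q(1) by (rule strict_total_on_subset)
      show "irrefl (X \<inter> Q \<times> Q)"
        using X(2) by (auto simp: irrefl_def)
      show "arc_compat lt e f" if "e \<in> X \<inter> Q \<times> Q" "f \<in> X \<inter> Q \<times> Q" for e f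
        using that X(3) by blast
      \<comment> \<open>Of two children on the same side, one lies under the arc of the other. By
        \<open>arc_compat\<close> their common head \<open>r\<close> would then lie strictly under
        that arc or at its tail.\<close>
      show "c = d" if "c \<in> {c \<in> Q. (c, r) \<in> X}" "d \<in> {c \<in> Q. (c, r) \<in> X}" for c d
      proof (rule ccontr)
        assume "c \<noteq> d"
        have cd: "c \<in> Q" "d \<in> Q" "c \<in> P" "d \<in> P" "c \<noteq> r" "d \<noteq> r" "(c, r) \<in> X" "(d, r) \<in> X"
          using that Q by auto
        have "\<not> strictly_between lt c d r" "\<not> strictly_between lt d c r"
          using X(3)[of "(c, r)" "(d, r)"] X(3)[of "(d, r)" "(c, r)"] cd irrefl r
          unfolding arc_compat_def strictly_between_def by auto
        moreover have "\<not> strictly_between lt c r d"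
          using out cd by blast
        ultimately show False
          using strictly_between_cases[OF ord, of c d r] strictly_between_commute[of lt] cd r \<open>c \<noteq> d\<close> by metis
      qed
      \<comment> \<open>If \<open>c\<close> lay under an arc (u, v) of \<open>Q\<close>, then
        \<open>r\<close> would lie under it as well or equal \<open>u\<close>; if c = u, then v = r.
        Neither happens inside \<open>Q\<close>.\<close>
      show "root_compat lt c e" if c: "c \<in> {c \<in> Q. (c, r) \<in> X}" and eX: "e \<in> X \<inter> Q \<times> Q" for c e
      proof -
        obtain u v where e: "e = (u, v)" "(u, v) \<in> X" "u \<in> Q" "v \<in> Q"
          using eX by blast
        have "arc_compat lt (u, v) (c, r)"
          using e c X(3) by blast
        then show ?thesis
          using e c out[of u v] Q unfolding arc_compat_def root_compat_def by auto
      qed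
    qed auto
    define L where "L = {p \<in> P. lt p r}"
    define R where "R = {p \<in> P. lt r p}"
    have nL: "\<not> lt r u" if "u \<in> L" for u
      using that asym[of u r] r unfolding L_def by blast
    have nR: "\<not> lt u r" if "u \<in> R" for u
      using that asym[of u r] r unfolding R_def by blast
    have sideL: "L \<subseteq> P" "r \<notin> L" "\<And>u v. u \<in> L \<Longrightarrow> v \<in> L \<Longrightarrow> \<not> strictly_between lt u r v"
      using nL irrefl[OF r] unfolding strictly_between_def L_def by auto
    obtain DL EL where L: "binary_parent_tree lt L DL EL" "X \<inter> L \<times> L \<subseteq> EL" "{c \<in> L. (c, r) \<in> X} \<subseteq> DL"
      using side[OF sideL] by blast
    have sideR: "R \<subseteq> P" "r \<notin> R" "\<And>u v. u \<in> R \<Longrightarrow> v \<in> R \<Longrightarrow> \<not> strictly_between lt u r v"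
      using nR irrefl[OF r] unfolding strictly_between_def R_def by auto
    obtain DR ER where R: "binary_parent_tree lt R DR ER" "X \<inter> R \<times> R \<subseteq> ER" "{c \<in> R. (c, r) \<in> X} \<subseteq> DR"
      using side[OF sideR] by blast
    let ?E = "EL \<union> ER \<union> (DL \<union> DR) \<times> {r}"
    have "binary_parent_tree lt P {r} ?E"
      by (rule binary_parent_tree_join[OF ord r L_def R_def L(1) R(1)])
    \<comment> \<open>An arc of \<open>X\<close> neither starts at \<open>r\<close> nor passes over
      it, so it stays on one side or ends at \<open>r\<close>.\<close>
    moreover have "X \<subseteq> ?E"
    proof (rule subrelI)
      fix x y assume xy: "(x, y) \<in> X"
      have "x \<noteq> r" "\<not> strictly_between lt x r y"
        using rX[OF xy] by (auto simp: root_compat_def)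
      moreover have "x \<in> P" "y \<in> P"
        using xy X by auto
      moreover have "x \<in> L \<or> x \<in> R" "y = r \<or> y \<in> L \<or> y \<in> R"
        using tot[of x r] tot[of y r] calculation r unfolding L_def R_def by auto
      ultimately have "(x, y) \<in> EL \<union> ER \<or> y = r"
        using xy L(2) R(2) unfolding L_def R_def strictly_between_def by blast
      then show "(x, y) \<in> ?E"
        using xy L(3) R(3) \<open>x \<in> L \<or> x \<in> R\<close> by blast
    qed
    ultimately show ?thesis
      using rD by blast
  qed
qed

section \<open>Parallel sets of a noncrossing partition\<close>

text \<open>Meant for one part \<open>V\<close> of the coarser partition and the parts of the finer
  one inside it. Nonemptiness of \<open>V\<close> keeps the empty set, which carries no rooted tree,
  from being a parallel set.\<close>

locale noncrossing_parts =
  fixes V :: "'a::linorder set" and S :: "'a set set"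
  assumes finite_V: "finite V" and V_nonempty: "V \<noteq> {}" and nc_partition: "noncrossing_partition V S"
begin

section \<open>Supports, the vertical order and covers\<close>

lemma partition: "partition_on V S"
  using nc_partition by (simp add: noncrossing_partition_def)

lemma finite_S: "finite S"
  using finite_elements[OF finite_V partition] .

lemma S_nonempty: "S \<noteq> {}"
  using partition V_nonempty by (auto simp: partition_on_def)

lemma part_finite: "A \<in> S \<Longrightarrow> finite A"
  using partition_onD1[OF partition] by (intro finite_subset[OF _ finite_V]) blast

lemma part_nonempty: "A \<in> S \<Longrightarrow> A \<noteq> {}"
  using partition partition_onD3 by blast

lemma part_disjoint: "A \<in> S \<Longrightarrow> B \<in> S \<Longrightarrow> x \<in> A \<Longrightarrow> x \<in> B \<Longrightarrow> A = B"
  using partition by (auto simp: partition_on_def disjoint_def)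

lemma Min_part: "A \<in> S \<Longrightarrow> Min A \<in> A" and Max_part: "A \<in> S \<Longrightarrow> Max A \<in> A"
  using part_finite part_nonempty by auto

lemma Min_le_part: "A \<in> S \<Longrightarrow> x \<in> A \<Longrightarrow> Min A \<le> x" and Max_ge_part: "A \<in> S \<Longrightarrow> x \<in> A \<Longrightarrow> x \<le> Max A"
  using part_finite by auto

lemma left_of_iff: "A \<in> S \<Longrightarrow> B \<in> S \<Longrightarrow> left_of A B \<longleftrightarrow> Max A < Min B"
  unfolding left_of_def using Min_part[of B] Max_part[of A] Min_le_part[of B] Max_ge_part[of A]
  by (meson le_less_trans less_le_trans)

lemma left_of_singleton_iff: "B \<in> S \<Longrightarrow> left_of {c} B \<longleftrightarrow> c < Min B"
  unfolding left_of_def using Min_part Min_le_part by (auto intro: less_le_trans)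

lemma left_of_singleton_iff': "A \<in> S \<Longrightarrow> left_of A {c} \<longleftrightarrow> Max A < c"
  unfolding left_of_def using Max_part Max_ge_part by (auto intro: le_less_trans)

lemma Min_le_Max: "A \<in> S \<Longrightarrow> Min A \<le> Max A"
  using Min_part Max_ge_part by blast

text \<open>Distinct parts share neither minimum nor maximum, so a proper inclusion of supports is
  strict at both ends.\<close>

lemma vless_iff: "A \<in> S \<Longrightarrow> B \<in> S \<Longrightarrow> vless A B \<longleftrightarrow> Min B < Min A \<and> Max A < Max B"
proof
  assume AB: "A \<in> S" "B \<in> S" and "vless A B"
  then have "{Min A..Max A} \<subset> {Min B..Max B}"
    by (simp add: vless_def supp_def)
  moreover from this have "A \<noteq> B"
    by blast
  moreover have "Min A \<noteq> Min B" "Max A \<noteq> Max B"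
    using part_disjoint[OF AB] Min_part Max_part AB \<open>A \<noteq> B\<close> by metis+
  ultimately show "Min B < Min A \<and> Max A < Max B"
    using Min_le_Max[OF AB(1)] by (auto simp: psubset_eq)
next
  assume AB: "A \<in> S" "B \<in> S" and "Min B < Min A \<and> Max A < Max B"
  then show "vless A B"
    using Min_le_Max by (auto simp: vless_def supp_def)
qed

lemma no_crossing:
  assumes "A \<in> S" "B \<in> S" "A \<noteq> B" "a \<in> A" "b \<in> B" "c \<in> A" "d \<in> B" "a < b" "b < c" "c < d"
  shows False
  using nc_partition assms unfolding noncrossing_partition_def noncrossing_def by metis

text \<open>For Min A < Min B the only other configuration is Min A < Min B < Max A < Max B, a
  crossing.\<close>

lemma parts_cases:
  assumes "A \<in> S" "B \<in> S" "A \<noteq> B"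
  shows "left_of A B \<or> left_of B A \<or> vless A B \<or> vless B A"
proof -
  have *: "left_of A B \<or> vless B A" if AB: "A \<in> S" "B \<in> S" "A \<noteq> B" and less: "Min A < Min B" for A B
  proof -
    note m = Min_part[OF AB(1)] Min_part[OF AB(2)] Max_part[OF AB(1)] Max_part[OF AB(2)]
    have "Max A \<noteq> Max B" "Max A \<noteq> Min B"
      using m part_disjoint AB by metis+
    moreover have "\<not> (Min B < Max A \<and> Max A < Max B)"
      using no_crossing[OF AB m(1,2,3,4) less] by blast
    ultimately show ?thesis
      using less AB by (auto simp: left_of_iff vless_iff)
  qed
  have "Min A \<noteq> Min B"
    using Min_part part_disjoint assms by metis
  then show ?thesis
    using *[of A B] *[of B A] assms by (metis linorder_neqE)
qed

lemma vless_trans: "vless A B \<Longrightarrow> vless B C \<Longrightarrow> vless A C"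
  unfolding vless_def by (rule psubset_trans)

lemma vless_irrefl: "\<not> vless A A"
  unfolding vless_def by blast

lemma coversD: "covers S C A \<Longrightarrow> C \<in> S \<and> A \<in> S \<and> vless A C"
  unfolding covers_def by blast

text \<open>Two supports containing that of \<open>A\<close> overlap, so their parts are vertically
  comparable, and the larger one is not directly above \<open>A\<close>.\<close>

lemma covers_unique:
  assumes "covers S C A" "covers S D A"
  shows "C = D"
proof (rule ccontr)
  assume "C \<noteq> D"
  have CD: "C \<in> S" "D \<in> S" "A \<in> S" "vless A C" "vless A D"
    using assms coversD by auto
  then have "\<not> left_of C D" "\<not> left_of D C"
    using Min_le_Max[of A] by (auto simp: vless_iff left_of_iff)
  then have "vless C D \<or> vless D C"
    using parts_cases CD \<open>C \<noteq> D\<close> by blast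
  then show False
    using assms CD unfolding covers_def by blast
qed

lemma covers_exists:
  assumes "A \<in> S" "\<not> vmaximal S A"
  obtains C where "covers S C A"
proof -
  let ?U = "{B \<in> S. vless A B}"
  have "?U \<noteq> {}" "finite ?U"
    using assms finite_S by (auto simp: vmaximal_def)
  then obtain C where C: "is_arg_min supp (\<lambda>B. B \<in> ?U) C"
    using ex_is_arg_min_if_finite by blast
  then have "covers S C A"
    using assms(1) unfolding is_arg_min_def covers_def vless_def by blast
  then show ?thesis
    using that by blast
qed

lemma vmaximal_exists: obtains A where "vmaximal S A"
proof -
  obtain A where "A \<in> S" "\<forall>B\<in>S. supp A \<subseteq> supp B \<longrightarrow> supp A = supp B"
    using finite_has_maximal[of "supp ` S"] finite_S S_nonempty by auto
  then have "vmaximal S A"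
    unfolding vmaximal_def vless_def by blast
  then show ?thesis
    using that by blast
qed

lemma covers_not_vmaximal: "covers S C A \<Longrightarrow> \<not> vmaximal S A"
  unfolding covers_def vmaximal_def by blast

text \<open>An element of \<open>C\<close> inside the support of \<open>B\<close> would give the
  crossing Min C < Min B < c < Max B. That each element of the covering part has a definite side of
  \<open>B\<close> is the key to \<open>parallel_trans\<close>.\<close>

lemma covers_between:
  assumes "covers S C B" "c \<in> C"
  shows "left_of {c} B \<or> left_of B {c}"
proof (rule ccontr)
  assume "\<not> ?thesis"
  moreover have CB: "C \<in> S" "B \<in> S" "vless B C"
    using assms coversD by auto
  ultimately have "Min B \<le> c" "c \<le> Max B"
    by (auto simp: left_of_singleton_iff left_of_singleton_iff')
  have "C \<noteq> B"
    using CB vless_irrefl by blast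
  then have "c \<noteq> Min B" "c \<noteq> Max B"
    using part_disjoint[OF CB(1,2) assms(2)] Min_part[OF CB(2)] Max_part[OF CB(2)] by metis+
  then have "Min B < c" "c < Max B"
    using \<open>Min B \<le> c\<close> \<open>c \<le> Max B\<close> by auto
  moreover have "Min C < Min B"
    using CB by (simp add: vless_iff)
  ultimately show False
    using no_crossing[OF CB(1,2), of "Min C" "Min B" c "Max B"] Min_part[OF CB(1)] Min_part[OF CB(2)]
      Max_part[OF CB(2)] assms(2) \<open>C \<noteq> B\<close> by simp
qed

section \<open>Parallelism as an equivalence relation\<close>

lemma parallelD: "parallel S A B \<Longrightarrow> A \<in> S \<and> B \<in> S \<and> A \<noteq> B"
  unfolding parallel_def by blast

lemma parallel_sym: "parallel S A B \<Longrightarrow> parallel S B A"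
  unfolding parallel_def strictly_between_def by blast

lemma covers_parallel: "covers S C A \<Longrightarrow> parallel S A B \<Longrightarrow> covers S C B"
  unfolding parallel_def using covers_unique covers_not_vmaximal by metis

lemma vmaximal_parallel: "vmaximal S A \<Longrightarrow> parallel S A B \<Longrightarrow> vmaximal S B"
  unfolding parallel_def using covers_not_vmaximal by blast

lemma parallel_gap: "parallel S A B \<Longrightarrow> covers S C A \<Longrightarrow> c \<in> C \<Longrightarrow> \<not> strictly_between left_of A {c} B"
  unfolding parallel_def using covers_unique covers_not_vmaximal by metis

text \<open>Under a common cover, an element between \<open>A\<close> and \<open>D\<close> lies on
  one side of \<open>B\<close>, so it already separates \<open>A\<close> from \<open>B\<close> or
  \<open>B\<close> from \<open>D\<close>.\<close>

lemma parallel_trans: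
  assumes AB: "parallel S A B" and BD: "parallel S B D" and "A \<noteq> D"
  shows "parallel S A D"
proof (cases "vmaximal S B")
  case True
  then have "vmaximal S A" "vmaximal S D"
    using vmaximal_parallel[OF _ parallel_sym[OF AB]] vmaximal_parallel[OF _ BD] by auto
  then show ?thesis
    using AB BD \<open>A \<noteq> D\<close> unfolding parallel_def by blast
next
  case False
  then obtain C where CB: "covers S C B"
    using covers_exists parallelD AB by metis
  have C: "covers S C A" "covers S C D"
    using covers_parallel[OF CB] parallel_sym[OF AB] BD by auto
  moreover have "\<not> strictly_between left_of A {c} D" if c: "c \<in> C" for c
    using parallel_gap[OF AB C(1) c] parallel_gap[OF BD CB c] covers_between[OF CB c]
    unfolding strictly_between_def by blast
  ultimately show ?thesis
    using AB BD \<open>A \<noteq> D\<close> unfolding parallel_def by blast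
qed

lemma parallel_left_of:
  assumes "parallel S A B"
  shows "left_of A B \<or> left_of B A"
proof -
  have "\<not> vless A B \<and> \<not> vless B A"
    using assms unfolding parallel_def vmaximal_def covers_def by blast
  then show ?thesis
    using parts_cases parallelD[OF assms] by blast
qed

definition parallel_class :: "'a set \<Rightarrow> 'a set set" where
  "parallel_class A = insert A {B. parallel S A B}"

lemma parallel_class_iff: "B \<in> parallel_class A \<longleftrightarrow> B = A \<or> parallel S A B"
  by (simp add: parallel_class_def)

lemma parallel_class_sym: "B \<in> parallel_class A \<Longrightarrow> A \<in> parallel_class B"
  using parallel_sym by (auto simp: parallel_class_iff)

lemma parallel_class_trans: "B \<in> parallel_class A \<Longrightarrow> C \<in> parallel_class B \<Longrightarrow> C \<in> parallel_class A"
  using parallel_trans by (auto simp: parallel_class_iff)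

lemma parallel_class_eq: "B \<in> parallel_class A \<Longrightarrow> parallel_class B = parallel_class A"
  using parallel_class_sym parallel_class_trans by (intro equalityI subsetI) metis+

lemma parallel_class_subset: "A \<in> S \<Longrightarrow> parallel_class A \<subseteq> S"
  using parallelD by (auto simp: parallel_class_iff)

lemma parallel_class_pairwise: "pairwise (parallel S) (parallel_class A)"
proof (rule pairwiseI)
  fix B C assume BC: "B \<in> parallel_class A" "C \<in> parallel_class A" "B \<noteq> C"
  then have "C \<in> parallel_class B"
    by (simp add: parallel_class_eq)
  then show "parallel S B C"
    using BC by (simp add: parallel_class_iff)
qed

text \<open>Maximal cliques of an equivalence relation are its classes; the empty clique is not
  maximal because \<open>S\<close> is nonempty. Every part thus lies in exactly one parallel set,
  and trees can be chosen class by class.\<close>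

lemma parallel_set_iff: "parallel_set S P \<longleftrightarrow> (\<exists>A\<in>S. P = parallel_class A)"
proof
  assume P: "parallel_set S P"
  have max: "Q = P" if "P \<subseteq> Q" "Q \<subseteq> S" "pairwise (parallel S) Q" for Q
    using P that unfolding parallel_set_def by blast
  obtain B where "B \<in> S"
    using S_nonempty by blast
  then have "P \<noteq> {}"
    using max[of "{B}"] by auto
  then obtain A where A: "A \<in> P"
    by blast
  then have "A \<in> S" "P \<subseteq> parallel_class A"
    using P unfolding parallel_set_def parallel_class_def pairwise_def by blast+
  then show "\<exists>A\<in>S. P = parallel_class A"
    using max[OF _ parallel_class_subset parallel_class_pairwise] by metis
next
  assume "\<exists>A\<in>S. P = parallel_class A"
  then obtain A where A: "A \<in> S" "P = parallel_class A"
    by blast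
  have "Q = P" if "P \<subseteq> Q" "pairwise (parallel S) Q" for Q
    using that A unfolding parallel_class_def pairwise_def by blast
  then show "parallel_set S P"
    unfolding parallel_set_def using A parallel_class_subset parallel_class_pairwise by metis
qed

lemma parallel_set_class: "A \<in> S \<Longrightarrow> parallel_set S (parallel_class A)"
  using parallel_set_iff by blast

lemma parallel_set_eq: "parallel_set S P \<Longrightarrow> A \<in> P \<Longrightarrow> P = parallel_class A"
  unfolding parallel_set_iff using parallel_class_eq by auto

lemma parallel_set_subset: "parallel_set S P \<Longrightarrow> P \<subseteq> S"
  unfolding parallel_set_def by blast

lemma parallel_set_finite: "parallel_set S P \<Longrightarrow> finite P"
  using finite_subset[OF parallel_set_subset finite_S] .

lemma parallel_set_pairwise: "parallel_set S P \<Longrightarrow> A \<in> P \<Longrightarrow> B \<in> P \<Longrightarrow> A \<noteq> B \<Longrightarrow> parallel S A B"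
  unfolding parallel_set_def pairwise_def by blast

lemma parallel_class_mem: "A \<in> parallel_class A"
  by (simp add: parallel_class_def)

lemma left_of_strict_total_on:
  assumes "parallel_set S P"
  shows "strict_total_on P left_of"
proof -
  have PS: "P \<subseteq> S"
    using assms by (rule parallel_set_subset)
  have "\<not> left_of A A" if "A \<in> P" for A
    using that PS Min_le_Max[of A] by (auto simp: left_of_iff)
  moreover have "left_of A C" if "A \<in> P" "B \<in> P" "C \<in> P" "left_of A B" "left_of B C" for A B C
    using that PS Min_le_Max[of B] by (auto simp: left_of_iff subset_iff)
  moreover have "left_of A B \<or> left_of B A" if "A \<in> P" "B \<in> P" "A \<noteq> B" for A B
    using that parallel_set_pairwise[OF assms] parallel_left_of by blast
  ultimately show ?thesis
    unfolding strict_total_on_def irreflp_on_def transp_on_def totalp_on_def by blast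
qed

lemma covers_not_parallel: "covers S B A \<Longrightarrow> \<not> parallel S A B"
  using covers_parallel[of B A B] coversD[of B B] vless_irrefl by blast

lemma edge_in_nc_edges_iff: "edge A B \<in> nc_edges S \<longleftrightarrow> parallel S A B \<or> covers S B A"
proof
  assume "edge A B \<in> nc_edges S"
  then obtain C D where CD: "edge A B = edge D C" "parallel S C D \<or> covers S C D"
    unfolding nc_edges_def by blast
  moreover have "D \<noteq> C"
    using CD(2) parallelD coversD vless_irrefl by metis
  ultimately have "D = A \<and> C = B"
    using edge_inject[of D C A B] by metis
  then show "parallel S A B \<or> covers S B A"
    using CD parallel_sym[of C D] by blast
next
  assume "parallel S A B \<or> covers S B A"
  then show "edge A B \<in> nc_edges S"
    unfolding nc_edges_def using parallel_sym[of A B] by blast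
qed

end

section \<open>The generated rooted tree\<close>

context noncrossing_parts
begin

lemma parallel_set_vmaximal: "parallel_set S (Collect (vmaximal S))"
proof -
  obtain A where A: "vmaximal S A"
    by (rule vmaximal_exists)
  have "parallel S A B" if "vmaximal S B" "B \<noteq> A" for B
    using A that unfolding parallel_def vmaximal_def by blast
  then have "parallel_class A = Collect (vmaximal S)"
    using A vmaximal_parallel[OF A] by (intro set_eqI) (metis mem_Collect_eq parallel_class_iff)
  then show ?thesis
    using A parallel_set_class[of A] by (auto simp: vmaximal_def)
qed

text \<open>The generated rooted tree made explicit, from a parent relation \<open>E P\<close> with
  root \<open>r P\<close> on each parallel set. The root of the maximal parallel set gets no arc,
  since nothing covers it, and becomes the root of the whole tree.\<close>

definition generated_arcs ::
    "('a set set \<Rightarrow> ('a set \<times> 'a set) set) \<Rightarrow> ('a set set \<Rightarrow> 'a set) \<Rightarrow> ('a set \<times> 'a set) set" where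
  "generated_arcs E r =
     {(A, B). \<exists>P. parallel_set S P \<and> ((A, B) \<in> E P \<or> (A = r P \<and> covers S B A))}"

lemma generated_arcs_cases:
  assumes "(A, B) \<in> generated_arcs E r"
  obtains P where "parallel_set S P" "(A, B) \<in> E P" | P where "parallel_set S P" "A = r P" "covers S B A"
  using assms unfolding generated_arcs_def by blast

context
  fixes E :: "'a set set \<Rightarrow> ('a set \<times> 'a set) set" and r :: "'a set set \<Rightarrow> 'a set"
  assumes trees: "\<And>P. parallel_set S P \<Longrightarrow> parent_tree P {r P} (E P)"
begin

lemma root_mem: "parallel_set S P \<Longrightarrow> r P \<in> P"
  and arc_mem: "parallel_set S P \<Longrightarrow> (A, B) \<in> E P \<Longrightarrow> A \<in> P \<and> B \<in> P"
  and Domain_arcs: "parallel_set S P \<Longrightarrow> Domain (E P) = P - {r P}"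
  and single_valued_arcs: "parallel_set S P \<Longrightarrow> single_valued (E P)"
  and arcs_reach_root: "parallel_set S P \<Longrightarrow> A \<in> P \<Longrightarrow> (A, r P) \<in> (E P)\<^sup>*"
  using trees[unfolded parent_tree_def] by auto

lemma arc_parallel:
  assumes "parallel_set S P" "(A, B) \<in> E P"
  shows "parallel S A B"
proof -
  have "A \<noteq> B"
    using parent_tree_irrefl[OF trees[OF assms(1)]] assms(2) by (auto simp: irrefl_def)
  then show ?thesis
    using parallel_set_pairwise[OF assms(1)] arc_mem[OF assms] by blast
qed

lemma arc_not_root:
  assumes "parallel_set S P" "(A, B) \<in> E P"
  shows "A \<noteq> r P"
  using Domain_arcs[OF assms(1)] DomainI[OF assms(2)] by simp

lemma generated_arcs_nc_edges: "(A, B) \<in> generated_arcs E r \<Longrightarrow> parallel S A B \<or> covers S B A"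
  by (elim generated_arcs_cases) (simp_all add: arc_parallel)

lemma generated_arcs_out:
  assumes "A \<in> S" "A \<noteq> r (Collect (vmaximal S))"
  shows "\<exists>B. (A, B) \<in> generated_arcs E r"
proof (cases "A = r (parallel_class A)")
  case True
  have "\<not> vmaximal S A"
  proof
    assume "vmaximal S A"
    then have "parallel_class A = Collect (vmaximal S)"
      using parallel_set_eq[OF parallel_set_vmaximal] by simp
    then show False
      using True assms(2) by simp
  qed
  then obtain C where "covers S C A"
    using covers_exists assms(1) by blast
  then show ?thesis
    using True parallel_set_class[OF assms(1)] unfolding generated_arcs_def by blast
next
  case False
  then have "A \<in> Domain (E (parallel_class A))"
    using Domain_arcs[OF parallel_set_class[OF assms(1)]] parallel_class_mem by simp
  then obtain B where "(A, B) \<in> E (parallel_class A)"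
    by (rule DomainE)
  then show ?thesis
    using parallel_set_class[OF assms(1)] unfolding generated_arcs_def by blast
qed

text \<open>A part lies in one parallel set. Arcs inside that set leave only its non-roots, the arc
  to the cover leaves only its root, and covers are unique.\<close>

lemma generated_arcs_single_valued: "single_valued (generated_arcs E r)"
proof (rule single_valuedI)
  fix A B C assume AB: "(A, B) \<in> generated_arcs E r" and AC: "(A, C) \<in> generated_arcs E r"
  have same: "P = Q" if "parallel_set S P" "A \<in> P" "parallel_set S Q" "A \<in> Q" for P Q
    using that parallel_set_eq by metis
  from AB show "B = C"
  proof (cases rule: generated_arcs_cases)
    case (1 P)
    note P = 1
    from AC show ?thesis
    proof (cases rule: generated_arcs_cases)
      case (1 Q)
      then have "P = Q"
        using same P arc_mem by blast
      then show ?thesis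
        using 1 P single_valued_arcs by (metis single_valuedD)
    next
      case (2 Q)
      then have "P = Q"
        using same P arc_mem root_mem by blast
      then show ?thesis
        using 2 P arc_not_root by blast
    qed
  next
    case (2 P)
    note P = 2
    from AC show ?thesis
    proof (cases rule: generated_arcs_cases)
      case (1 Q)
      then have "P = Q"
        using same P arc_mem root_mem by blast
      then show ?thesis
        using 1 P arc_not_root by blast
    next
      case (2 Q)
      then show ?thesis
        using P covers_unique by blast
    qed
  qed
qed

text \<open>From \<open>A\<close> one climbs to the root of its parallel set and then to the part
  covering that root. This part also covers \<open>A\<close>, so strictly fewer parts lie above
  it.\<close>

lemma generated_arcs_reach:
  assumes "A \<in> S"
  shows "(A, r (Collect (vmaximal S))) \<in> (generated_arcs E r)\<^sup>*"
  using assms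
proof (induction "card {B \<in> S. vless A B}" arbitrary: A rule: less_induct)
  case less
  let ?P = "parallel_class A" and ?G = "generated_arcs E r"
  have P: "parallel_set S ?P"
    using parallel_set_class less.prems .
  have "E ?P \<subseteq> ?G"
    using P unfolding generated_arcs_def by blast
  then have root: "(A, r ?P) \<in> ?G\<^sup>*"
    using arcs_reach_root[OF P parallel_class_mem] rtrancl_mono by blast
  show ?case
  proof (cases "vmaximal S A")
    case True
    then have "?P = Collect (vmaximal S)"
      using parallel_set_eq[OF parallel_set_vmaximal] by simp
    then show ?thesis
      using root by simp
  next
    case False
    then obtain C where C: "covers S C A"
      using covers_exists less.prems by blast
    have "r ?P \<in> ?P"
      using root_mem P .
    then have "covers S C (r ?P)"
      using C covers_parallel by (auto simp: parallel_class_iff)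
    then have "(r ?P, C) \<in> ?G"
      using P unfolding generated_arcs_def by blast
    moreover have "(C, r (Collect (vmaximal S))) \<in> ?G\<^sup>*"
    proof (rule less.hyps)
      show "C \<in> S"
        using C coversD by blast
      have "{B \<in> S. vless C B} \<subset> {B \<in> S. vless A B}"
        using coversD[OF C] vless_trans[of A C] vless_irrefl[of C] by blast
      then show "card {B \<in> S. vless C B} < card {B \<in> S. vless A B}"
        using finite_S by (intro psubset_card_mono) auto
    qed
    ultimately show ?thesis
      using root by (meson converse_rtrancl_into_rtrancl rtrancl_trans)
  qed
qed

lemma generated_arcs_parent_tree: "parent_tree S {r (Collect (vmaximal S))} (generated_arcs E r)"
proof -
  let ?G = "generated_arcs E r" and ?M = "Collect (vmaximal S)"
  have "r ?M \<in> S"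
    using root_mem[OF parallel_set_vmaximal] by (auto simp: vmaximal_def)
  moreover have sub: "?G \<subseteq> S \<times> S"
    using generated_arcs_nc_edges parallelD coversD by (intro subrelI) blast
  moreover have "r ?M \<notin> Domain ?G"
  proof
    assume "r ?M \<in> Domain ?G"
    then obtain B where "(r ?M, B) \<in> ?G"
      by (rule DomainE)
    then show False
    proof (cases rule: generated_arcs_cases)
      case (1 P)
      then have "P = ?M"
        using arc_mem root_mem[OF parallel_set_vmaximal] parallel_set_eq parallel_set_vmaximal by metis
      then show False
        using 1 arc_not_root by blast
    next
      case (2 P)
      then show False
        using covers_not_vmaximal root_mem[OF parallel_set_vmaximal] by auto
    qed
  qed
  then have "Domain ?G = S - {r ?M}"
    using generated_arcs_out sub by auto
  ultimately show ?thesis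
    using generated_arcs_single_valued generated_arcs_reach unfolding parent_tree_def by simp
qed

text \<open>The parent of the root of a parallel set cannot be parallel to it, as this would close a cycle.\<close>

lemma generated_arcs_unique:
  assumes F: "parent_tree S {s} F" and EF: "\<And>P. parallel_set S P \<Longrightarrow> E P \<subseteq> F"
    and nc: "\<And>A B. (A, B) \<in> F \<Longrightarrow> parallel S A B \<or> covers S B A"
  shows "F = generated_arcs E r"
proof -
  let ?M = "Collect (vmaximal S)"
  have acyc: "(A, A) \<notin> F\<^sup>+" for A
    using parent_tree_acyclic[OF F] by (auto simp: acyclic_def)
  have covers: "covers S B (r P)" if P: "parallel_set S P" and B: "(r P, B) \<in> F" for P B
  proof (rule ccontr)
    assume "\<not> covers S B (r P)"
    then have "parallel S (r P) B"
      using nc[OF B] by blast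
    then have "B \<in> P"
      using parallel_set_eq[OF P root_mem[OF P]] parallel_class_iff by metis
    then have "(B, r P) \<in> F\<^sup>*"
      using arcs_reach_root[OF P] subsetD[OF rtrancl_mono[OF EF[OF P]]] by simp
    then show False
      using rtrancl_into_trancl2[OF B] acyc by blast
  qed
  have Dom: "Domain F = S - {s}"
    using F by (simp add: parent_tree_def)
  have M: "r ?M \<in> S" "vmaximal S (r ?M)"
    using root_mem[OF parallel_set_vmaximal] by (auto simp: vmaximal_def)
  \<comment> \<open>By \<open>covers\<close>, an arc from this root would lead to a part covering
    it, which a maximal part does not have. So both trees have the same root.\<close>
  have "r ?M \<notin> Domain F"
    using covers[OF parallel_set_vmaximal] covers_not_vmaximal M by auto
  then have s: "s = r ?M"
    using Dom M by auto
  have "generated_arcs E r \<subseteq> F"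
  proof (rule subrelI)
    fix A B assume "(A, B) \<in> generated_arcs E r"
    then show "(A, B) \<in> F"
    proof (cases rule: generated_arcs_cases)
      case (1 P)
      then show ?thesis
        using EF by blast
    next
      case (2 P)
      then have "A \<noteq> s" "A \<in> S"
        using covers_not_vmaximal M s coversD by auto
      then have "A \<in> Domain F"
        using Dom by simp
      then obtain B' where B': "(A, B') \<in> F"
        by (rule DomainE)
      then have "covers S B' A"
        using covers 2 by blast
      then show ?thesis
        using B' 2 covers_unique by blast
    qed
  qed
  then show ?thesis
    using parent_tree_subset_eq[OF generated_arcs_parent_tree F] by simp
qed

end

text \<open>Replaces the definite description by an explicit arc set, in which edges inside a
  parallel set and edges to a cover can be told apart.\<close>

lemma generated_tree_eq:
  assumes t: "\<And>P. parallel_set S P \<Longrightarrow> case_prod edge ` arcs (t P) = t P"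
    and r: "\<And>P. parallel_set S P \<Longrightarrow> parent_tree P {r P} (arcs (t P))"
  shows "generated_tree S (\<Union>P\<in>Collect (parallel_set S). t P) =
    case_prod edge ` generated_arcs (\<lambda>P. arcs (t P)) r"
  unfolding generated_tree_def
proof (rule the_equality, intro conjI)
  let ?G = "generated_arcs (\<lambda>P. arcs (t P)) r"
  show "rooted_tree S (case_prod edge ` ?G)"
    by (rule parent_tree_rooted_tree[OF finite_S generated_arcs_parent_tree[OF r]])
  show "(\<Union>P\<in>Collect (parallel_set S). t P) \<subseteq> case_prod edge ` ?G"
  proof
    fix e assume "e \<in> (\<Union>P\<in>Collect (parallel_set S). t P)"
    then obtain P where P: "parallel_set S P" "e \<in> case_prod edge ` arcs (t P)"
      using t by auto
    moreover have "arcs (t P) \<subseteq> ?G"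
      using P(1) unfolding generated_arcs_def by blast
    ultimately show "e \<in> case_prod edge ` ?G"
      by blast
  qed
  show "case_prod edge ` ?G \<subseteq> nc_edges S"
    using generated_arcs_nc_edges[OF r] by (auto simp: edge_in_nc_edges_iff)
next
  fix T assume T: "rooted_tree S T \<and> (\<Union>P\<in>Collect (parallel_set S). t P) \<subseteq> T \<and> T \<subseteq> nc_edges S"
  then obtain s where s: "parent_tree S {s} (arcs T)" "case_prod edge ` arcs T = T"
    using rooted_tree_parent_tree[OF finite_S] by blast
  have "arcs T = generated_arcs (\<lambda>P. arcs (t P)) r"
  proof (rule generated_arcs_unique[OF r s(1)])
    show "arcs (t P) \<subseteq> arcs T" if "parallel_set S P" for P
      using that T by (auto simp: arcs_def)
    show "parallel S A B \<or> covers S B A" if "(A, B) \<in> arcs T" for A B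
      using that T edge_in_nc_edges_iff by (auto simp: arcs_def)
  qed
  then show "T = case_prod edge ` generated_arcs (\<lambda>P. arcs (t P)) r"
    using s(2) by simp
qed

text \<open>Edges whose sources lie in different parallel sets do not constrain each other; within
  one set, a covering edge declares its source to be the root. The mixed case is written in one
  order only, since the condition is imposed on both orders of a pair.\<close>

definition edge_compat :: "'a set \<times> 'a set \<Rightarrow> 'a set \<times> 'a set \<Rightarrow> bool" where
  "edge_compat = (\<lambda>(x, y) (u, v). u \<in> parallel_class x \<longrightarrow>
     (parallel S x y \<longrightarrow> parallel S u v \<longrightarrow> arc_compat left_of (x, y) (u, v)) \<and>
     (parallel S x y \<longrightarrow> covers S v u \<longrightarrow> root_compat left_of u (x, y)) \<and>
     (covers S y x \<longrightarrow> covers S v u \<longrightarrow> x = u))"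

text \<open>Bridges a gap: \<open>pairwise\<close> speaks of distinct edges only, whereas
  \<open>edge_compat_extend\<close> asks for all pairs.\<close>

lemma edge_compat_refl: "edge_compat (x, y) (x, y)"
proof -
  have "\<not> covers S y x" "\<not> left_of x x" "\<not> left_of y y" "x \<noteq> y" if "parallel S x y"
    using that covers_not_parallel[of y x] parallelD[OF that] Min_le_Max[of x] Min_le_Max[of y]
    by (auto simp: left_of_iff)
  then show ?thesis
    unfolding edge_compat_def arc_compat_def strictly_between_def by auto
qed

text \<open>In the generated tree an edge between parallel parts belongs to the binary tree on their
  class, and a covering edge leaves the root of its class. So everything reduces to
  \<open>binary_tree_compat\<close> on a single class.\<close>

lemma binary_forest_generated:
  assumes "binary_forest S F"
  obtains s where "parent_tree S {s} (arcs (generated_tree S F))"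
    "case_prod edge ` arcs (generated_tree S F) = generated_tree S F"
    "generated_tree S F \<subseteq> nc_edges S"
    "\<And>e f. e \<in> arcs (generated_tree S F) \<Longrightarrow> f \<in> arcs (generated_tree S F) \<Longrightarrow> edge_compat e f"
proof -
  obtain t where t: "\<And>P. parallel_set S P \<Longrightarrow> binary_tree left_of P (t P)"
    and F: "F = (\<Union>P\<in>Collect (parallel_set S). t P)"
    using assms unfolding binary_forest_def by blast
  have "\<exists>r. parallel_set S P \<longrightarrow> parent_tree P {r} (arcs (t P)) \<and> case_prod edge ` arcs (t P) = t P \<and>
      (\<forall>e\<in>arcs (t P). \<forall>f\<in>arcs (t P). arc_compat left_of e f) \<and> (\<forall>e\<in>arcs (t P). root_compat left_of r e)" for P
  proof (cases "parallel_set S P")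
    case True
    show ?thesis
      by (rule binary_tree_compat[OF parallel_set_finite[OF True] left_of_strict_total_on[OF True] t[OF True]])
        blast
  qed blast
  then obtain r where r: "parallel_set S P \<Longrightarrow> parent_tree P {r P} (arcs (t P))"
    and im: "parallel_set S P \<Longrightarrow> case_prod edge ` arcs (t P) = t P"
    and ac: "parallel_set S P \<Longrightarrow> e \<in> arcs (t P) \<Longrightarrow> f \<in> arcs (t P) \<Longrightarrow> arc_compat left_of e f"
    and rc: "parallel_set S P \<Longrightarrow> e \<in> arcs (t P) \<Longrightarrow> root_compat left_of (r P) e" for P e f
    by metis
  let ?G = "generated_arcs (\<lambda>P. arcs (t P)) r"
  have gt: "generated_tree S F = case_prod edge ` ?G"
    unfolding F by (rule generated_tree_eq[OF im r])
  have pt: "parent_tree S {r (Collect (vmaximal S))} ?G"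
    by (rule generated_arcs_parent_tree[OF r])
  have arcs: "arcs (generated_tree S F) = ?G"
    unfolding gt by (rule arcs_edge_image[OF parent_tree_irrefl[OF pt]])
  have par: "(x, y) \<in> arcs (t (parallel_class x))" if "(x, y) \<in> ?G" "parallel S x y" for x y
    using that(1)
  proof (cases rule: generated_arcs_cases)
    case (1 P)
    then show ?thesis
      using parallel_set_eq arc_mem[OF r] by metis
  next
    case (2 P)
    then show ?thesis
      using that covers_not_parallel by blast
  qed
  have cov: "x = r (parallel_class x)" if "(x, y) \<in> ?G" "covers S y x" for x y
    using that(1)
  proof (cases rule: generated_arcs_cases)
    case (1 P)
    then show ?thesis
      using that arc_parallel[OF r] covers_not_parallel by blast
  next
    case (2 P)
    then show ?thesis
      using parallel_set_eq root_mem[OF r] by metis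
  qed
  have "edge_compat (x, y) (u, v)" if xy: "(x, y) \<in> ?G" and uv: "(u, v) \<in> ?G" for x y u v
    unfolding edge_compat_def split
  proof (intro impI conjI)
    assume "u \<in> parallel_class x"
    then have eq: "parallel_class u = parallel_class x"
      by (rule parallel_class_eq)
    have "x \<in> S"
      using xy pt unfolding parent_tree_def by blast
    then have P: "parallel_set S (parallel_class x)"
      by (rule parallel_set_class)
    show "arc_compat left_of (x, y) (u, v)" if "parallel S x y" "parallel S u v"
      using ac[OF P] par[OF xy] par[OF uv] that eq by simp
    show "root_compat left_of u (x, y)" if "parallel S x y" "covers S v u"
      using rc[OF P par[OF xy that(1)]] cov[OF uv that(2)] eq by simp
    show "x = u" if "covers S y x" "covers S v u"
      using cov[OF xy that(1)] cov[OF uv that(2)] eq by simp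
  qed
  then have "edge_compat e f" if "e \<in> ?G" "f \<in> ?G" for e f
    using that by (cases e; cases f) blast
  moreover have "case_prod edge ` ?G \<subseteq> nc_edges S"
    using generated_arcs_nc_edges[OF r] by (auto simp: edge_in_nc_edges_iff)
  ultimately show ?thesis
    by (intro that[of "r (Collect (vmaximal S))"]) (simp_all add: arcs[unfolded gt] gt pt)
qed

text \<open>On each class, \<open>arc_compat_extend\<close> receives the arcs of \<open>X\<close>
  inside the class and, as prescribed root, the source of its covering edges, which is unique by
  \<open>edge_compat\<close>. The covering edges themselves reappear when the forest generates its
  tree.\<close>

lemma edge_compat_extend:
  assumes X: "\<And>x y. (x, y) \<in> X \<Longrightarrow> parallel S x y \<or> covers S y x"
    and compat: "\<And>e f. e \<in> X \<Longrightarrow> f \<in> X \<Longrightarrow> edge_compat e f"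
  obtains F where "binary_forest S F" "X \<subseteq> arcs (generated_tree S F)"
proof -
  define Q where "Q P D E \<longleftrightarrow> binary_parent_tree left_of P D E \<and> X \<inter> P \<times> P \<subseteq> E \<and>
    {x \<in> P. \<exists>y. (x, y) \<in> X \<and> covers S y x} \<subseteq> D" for P D E
  have "\<exists>D E. Q P D E" if P: "parallel_set S P" for P
    unfolding Q_def
  proof (rule arc_compat_extend[OF parallel_set_finite[OF P] left_of_strict_total_on[OF P]])
    have cl: "u \<in> parallel_class x" if "x \<in> P" "u \<in> P" for x u
      using that parallel_set_eq[OF P] by metis
    have par: "parallel S x y" if "(x, y) \<in> X" "x \<in> P" "y \<in> P" for x y
    proof -
      have "x \<noteq> y"
        using X[OF that(1)] parallelD coversD vless_irrefl by metis
      then show ?thesis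
        using parallel_set_pairwise[OF P] that by blast
    qed
    show "irrefl (X \<inter> P \<times> P)"
      using par parallelD by (auto simp: irrefl_def)
    show "arc_compat left_of e f" if "e \<in> X \<inter> P \<times> P" "f \<in> X \<inter> P \<times> P" for e f
    proof -
      obtain x y u v where "e = (x, y)" "f = (u, v)"
        by (cases e; cases f) blast
      then show ?thesis
        using that compat[of e f] par[of x y] par[of u v] cl[of x u] unfolding edge_compat_def by auto
    qed
    show "c = d" if c: "c \<in> {x \<in> P. \<exists>y. (x, y) \<in> X \<and> covers S y x}"
      and d: "d \<in> {x \<in> P. \<exists>y. (x, y) \<in> X \<and> covers S y x}" for c d
    proof -
      obtain y v where "(c, y) \<in> X" "covers S y c" "(d, v) \<in> X" "covers S v d"
        using c d by auto
      then show ?thesis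
        using c d compat[of "(c, y)" "(d, v)"] cl[of c d] unfolding edge_compat_def by auto
    qed
    show "root_compat left_of d e" if d: "d \<in> {x \<in> P. \<exists>y. (x, y) \<in> X \<and> covers S y x}" and e: "e \<in> X \<inter> P \<times> P" for d e
    proof -
      obtain v where v: "(d, v) \<in> X" "covers S v d"
        using d by auto
      obtain x y where "e = (x, y)"
        by (cases e)
      then show ?thesis
        using d e v compat[of "(x, y)" "(d, v)"] cl[of x d] par[of x y] unfolding edge_compat_def by auto
    qed
  qed auto
  then obtain D E where "\<And>P. parallel_set S P \<Longrightarrow> Q P (D P) (E P)"
    by metis
  then have DE: "binary_parent_tree left_of P (D P) (E P)" "X \<inter> P \<times> P \<subseteq> E P"
    "{x \<in> P. \<exists>y. (x, y) \<in> X \<and> covers S y x} \<subseteq> D P" if "parallel_set S P" for P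
    using that unfolding Q_def by simp_all
  \<comment> \<open>\<open>D P\<close> is not empty because the class is not and each of its members
    reaches \<open>D P\<close>.\<close>
  have "\<exists>r. parallel_set S P \<longrightarrow> D P = {r}" for P
  proof (cases "parallel_set S P")
    case True
    then obtain A where "A \<in> P"
      using parallel_set_iff parallel_class_mem by metis
    then show ?thesis
      using DE(1)[OF True] unfolding binary_parent_tree_def parent_tree_def
      by (metis empty_iff insertI1 subsetI subset_antisym subset_singletonD singletonD)
  qed blast
  then obtain r where r: "\<And>P. parallel_set S P \<Longrightarrow> D P = {r P}"
    by metis
  define t where "t P = case_prod edge ` E P" for P
  have pt: "parent_tree P {r P} (E P)" if "parallel_set S P" for P
    using DE(1)[OF that] r[OF that] by (simp add: binary_parent_tree_def)
  have arcs_t: "arcs (t P) = E P" if "parallel_set S P" for P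
    unfolding t_def by (rule arcs_edge_image[OF parent_tree_irrefl[OF pt[OF that]]])
  define F where "F = (\<Union>P\<in>Collect (parallel_set S). t P)"
  have "binary_tree left_of P (t P)" if "parallel_set S P" for P
    unfolding t_def
    using binary_parent_tree_binary_tree[OF parallel_set_finite[OF that] left_of_strict_total_on[OF that]]
      DE(1)[OF that] r[OF that] by simp
  then have forest: "binary_forest S F"
    unfolding binary_forest_def F_def by blast
  let ?G = "generated_arcs (\<lambda>P. arcs (t P)) r"
  have pt': "parent_tree P {r P} (arcs (t P))" if "parallel_set S P" for P
    using pt[OF that] arcs_t[OF that] by simp
  have "case_prod edge ` arcs (t P) = t P" if "parallel_set S P" for P
    using arcs_t[OF that] by (simp add: t_def)
  then have "generated_tree S F = case_prod edge ` ?G"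
    unfolding F_def by (rule generated_tree_eq[OF _ pt'])
  then have arcs: "arcs (generated_tree S F) = ?G"
    using arcs_edge_image[OF parent_tree_irrefl[OF generated_arcs_parent_tree[OF pt']]] by simp
  have "X \<subseteq> ?G"
  proof (rule subrelI)
    fix x y assume xy: "(x, y) \<in> X"
    have "x \<in> S"
      using X[OF xy] parallelD coversD by blast
    then have P: "parallel_set S (parallel_class x)"
      by (rule parallel_set_class)
    from X[OF xy] show "(x, y) \<in> ?G"
    proof
      assume "parallel S x y"
      then have "(x, y) \<in> E (parallel_class x)"
        using DE(2)[OF P] xy by (auto simp: parallel_class_iff)
      then show ?thesis
        using P arcs_t[OF P] unfolding generated_arcs_def by blast
    next
      assume c: "covers S y x"
      then have "x \<in> D (parallel_class x)"
        using DE(3)[OF P] xy parallel_class_mem by blast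
      then show ?thesis
        using P r[OF P] c unfolding generated_arcs_def by blast
    qed
  qed
  then show ?thesis
    using that forest arcs by metis
qed

end

section \<open>Cluster morphisms\<close>

lemma noncrossing_subset:
  assumes "noncrossing S" "T \<subseteq> S"
  shows "noncrossing T"
  unfolding noncrossing_def
proof (intro ballI impI)
  fix A B assume "A \<in> T" "B \<in> T" "A \<noteq> B"
  then show "\<not> (\<exists>a b c d. a < b \<and> b < c \<and> c < d \<and> a \<in> A \<and> c \<in> A \<and> b \<in> B \<and> d \<in> B)"
    using assms(1)[unfolded noncrossing_def, rule_format, of A B] assms(2) by blast
qed

locale nc_refinement =
  fixes V :: "'a::linorder set" and R S :: "'a set set"
  assumes finite_V: "finite V" and nc: "noncrossing_partition V S" and refines: "refines V S R"
begin

abbreviation edges_in :: "'a set \<Rightarrow> ('a set \<Rightarrow>\<^sub>0 int) set" where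
  "edges_in W \<equiv> nc_edges (parts_in S W)"

lemma parts_in_noncrossing:
  assumes "W \<in> R"
  shows "noncrossing_parts W (parts_in S W)"
proof
  have S: "partition_on V S" and R: "partition_on V R" and ref: "\<And>A. A \<in> S \<Longrightarrow> \<exists>Y\<in>R. A \<subseteq> Y"
    using refines by (auto simp: refines_def)
  have WV: "W \<subseteq> V"
    using R assms partition_onD1 by blast
  then show "finite W"
    using finite_V by (rule finite_subset)
  show "W \<noteq> {}"
    using R assms partition_onD3 by blast
  have "x \<in> \<Union>(parts_in S W)" if x: "x \<in> W" for x
  proof -
    have "x \<in> \<Union>S"
      using partition_onD1[OF S] WV x by blast
    then obtain A where A: "A \<in> S" "x \<in> A"
      by blast
    then obtain Y where Y: "Y \<in> R" "A \<subseteq> Y"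
      using ref by blast
    then have "Y = W"
      using disjointD[OF partition_onD2[OF R] Y(1) assms] A x by blast
    then show ?thesis
      using A Y by (auto simp: parts_in_def)
  qed
  then have "partition_on W (parts_in S W)"
    using S by (auto simp: partition_on_def disjoint_def parts_in_def)
  then show "noncrossing_partition W (parts_in S W)"
    using nc noncrossing_subset[of S "parts_in S W"]
    by (auto simp: noncrossing_partition_def parts_in_def)
qed

lemma edges_in_cases:
  assumes "W \<in> R" "e \<in> edges_in W"
  obtains A B where "e = edge A B" "A \<noteq> B" "A \<in> parts_in S W"
    "parallel (parts_in S W) A B \<or> covers (parts_in S W) B A"
proof -
  interpret noncrossing_parts W "parts_in S W"
    using assms(1) by (rule parts_in_noncrossing)
  obtain A B where "e = edge A B" "parallel (parts_in S W) B A \<or> covers (parts_in S W) B A"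
    using assms(2) unfolding nc_edges_def by blast
  then show ?thesis
    using that[of A B] parallel_sym[of B A] parallelD[of B A] coversD[of B A] vless_irrefl[of A] by metis
qed

text \<open>An edge determines its source, a nonempty part of \<open>S\<close>, which lies in only
  one part of \<open>R\<close>.\<close>

lemma edges_in_disjoint:
  assumes "W \<in> R" "W' \<in> R" "e \<in> edges_in W" "e \<in> edges_in W'"
  shows "W = W'"
proof -
  obtain A B where AB: "e = edge A B" "A \<noteq> B" "A \<in> parts_in S W"
    using edges_in_cases[OF assms(1,3)] by metis
  obtain C D where CD: "e = edge C D" "C \<in> parts_in S W'"
    using edges_in_cases[OF assms(2,4)] by metis
  have "A = C"
    using edge_inject[of A B C D] AB CD by simp
  then have "A \<subseteq> W" "A \<subseteq> W'" "A \<in> S"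
    using AB CD by (auto simp: parts_in_def)
  moreover from this have "A \<noteq> {}"
    using nc partition_onD3 by (auto simp: noncrossing_partition_def)
  moreover have "disjoint R"
    using refines partition_onD2 by (auto simp: refines_def)
  ultimately show ?thesis
    using disjointD[of R W W'] assms(1,2) by blast
qed

lemma generated_tree_edges_in:
  assumes "W \<in> R" "binary_forest (parts_in S W) F"
  shows "generated_tree (parts_in S W) F \<subseteq> edges_in W"
proof -
  interpret noncrossing_parts W "parts_in S W"
    using assms(1) by (rule parts_in_noncrossing)
  show ?thesis
    using binary_forest_generated[OF assms(2)] by metis
qed

text \<open>By \<open>edges_in_disjoint\<close>, the tree chosen for \<open>W\<close> can be read
  off from \<open>T\<close>. This is how statements about cluster morphisms are reduced to single
  parts of \<open>R\<close>.\<close>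

lemma cluster_morphism_restrict:
  assumes f: "\<And>W. W \<in> R \<Longrightarrow> binary_forest (parts_in S W) (f W)"
    and T: "T = (\<Union>W\<in>R. generated_tree (parts_in S W) (f W))" and W: "W \<in> R"
  shows "T \<inter> edges_in W = generated_tree (parts_in S W) (f W)"
proof (intro equalityI subsetI)
  fix e assume e: "e \<in> T \<inter> edges_in W"
  then obtain W' where W': "W' \<in> R" "e \<in> generated_tree (parts_in S W') (f W')"
    using T by blast
  then have "e \<in> edges_in W'"
    using generated_tree_edges_in f by blast
  then have "W' = W"
    using edges_in_disjoint W W' e by blast
  then show "e \<in> generated_tree (parts_in S W) (f W)"
    using W' by simp
next
  fix e assume "e \<in> generated_tree (parts_in S W) (f W)"
  then show "e \<in> T \<inter> edges_in W"
    using T W generated_tree_edges_in[OF W f[OF W]] by blast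
qed

lemma cluster_morphism_subset_rel_edges:
  assumes "cluster_morphism R S T"
  shows "T \<subseteq> rel_edges S R"
proof -
  obtain f where f: "\<And>W. W \<in> R \<Longrightarrow> binary_forest (parts_in S W) (f W)"
    and T: "T = (\<Union>W\<in>R. generated_tree (parts_in S W) (f W))"
    using assms unfolding cluster_morphism_def by blast
  show ?thesis
    unfolding T rel_edges_def using generated_tree_edges_in[OF _ f] by (rule UN_mono[OF subset_refl])
qed

lemma cluster_morphism_subset_eq:
  assumes T: "cluster_morphism R S T" and T': "cluster_morphism R S T'" and sub: "T \<subseteq> T'"
  shows "T = T'"
proof -
  obtain f where f: "\<And>W. W \<in> R \<Longrightarrow> binary_forest (parts_in S W) (f W)"
    and Tf: "T = (\<Union>W\<in>R. generated_tree (parts_in S W) (f W))"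
    using T unfolding cluster_morphism_def by blast
  obtain g where g: "\<And>W. W \<in> R \<Longrightarrow> binary_forest (parts_in S W) (g W)"
    and Tg: "T' = (\<Union>W\<in>R. generated_tree (parts_in S W) (g W))"
    using T' unfolding cluster_morphism_def by blast
  have "generated_tree (parts_in S W) (f W) = generated_tree (parts_in S W) (g W)" if W: "W \<in> R" for W
  proof -
    interpret noncrossing_parts W "parts_in S W"
      using W by (rule parts_in_noncrossing)
    let ?A = "generated_tree (parts_in S W) (f W)" and ?B = "generated_tree (parts_in S W) (g W)"
    have "?A \<subseteq> ?B"
      using cluster_morphism_restrict[OF f Tf W] cluster_morphism_restrict[OF g Tg W] sub by blast
    then have "arcs ?A \<subseteq> arcs ?B"
      by (auto simp: arcs_def)
    moreover obtain s where "parent_tree (parts_in S W) {s} (arcs ?A)" "case_prod edge ` arcs ?A = ?A"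
      by (rule binary_forest_generated[OF f[OF W]])
    moreover obtain s' where "parent_tree (parts_in S W) {s'} (arcs ?B)" "case_prod edge ` arcs ?B = ?B"
      by (rule binary_forest_generated[OF g[OF W]])
    ultimately show ?thesis
      using parent_tree_subset_eq by metis
  qed
  then show ?thesis
    unfolding Tf Tg by (rule SUP_cong[OF refl])
qed

section \<open>Gluing pairwise compatible edges\<close>

lemma compatible_edge_compat:
  assumes W: "W \<in> R" and comp: "compatible R S (edge x y) (edge u v)"
    and xy: "edge x y \<in> edges_in W" and uv: "edge u v \<in> edges_in W"
  shows "noncrossing_parts.edge_compat (parts_in S W) (x, y) (u, v)"
proof -
  interpret noncrossing_parts W "parts_in S W"
    using W by (rule parts_in_noncrossing)
  obtain T where T: "cluster_morphism R S T" "edge x y \<in> T" "edge u v \<in> T"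
    using comp unfolding compatible_def by blast
  obtain f where f: "\<And>W. W \<in> R \<Longrightarrow> binary_forest (parts_in S W) (f W)"
    and Tf: "T = (\<Union>W\<in>R. generated_tree (parts_in S W) (f W))"
    using T(1) unfolding cluster_morphism_def by blast
  have "(x, y) \<in> arcs (generated_tree (parts_in S W) (f W))"
    "(u, v) \<in> arcs (generated_tree (parts_in S W) (f W))"
    using cluster_morphism_restrict[OF f Tf W] T xy uv unfolding arcs_def by auto
  then show ?thesis
    using binary_forest_generated[OF f[OF W]] by metis
qed

lemma compatible_extend:
  assumes T: "T \<subseteq> rel_edges S R" and comp: "pairwise (compatible R S) T"
  obtains T' where "cluster_morphism R S T'" "T \<subseteq> T'"
proof -
  have "\<exists>F. binary_forest (parts_in S W) F \<and> T \<inter> edges_in W \<subseteq> generated_tree (parts_in S W) F"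
    if W: "W \<in> R" for W
  proof -
    interpret noncrossing_parts W "parts_in S W"
      using W by (rule parts_in_noncrossing)
    define X where "X = arcs (T \<inter> edges_in W)"
    have X: "parallel (parts_in S W) x y \<or> covers (parts_in S W) y x" if "(x, y) \<in> X" for x y
      using that by (simp add: X_def arcs_def edge_in_nc_edges_iff)
    have "edge_compat (x, y) (u, v)" if xy: "(x, y) \<in> X" and uv: "(u, v) \<in> X" for x y u v
    proof (cases "edge x y = edge u v")
      case True
      have "x \<noteq> y"
        using X[OF xy] parallelD coversD vless_irrefl by metis
      then show ?thesis
        using edge_inject[OF True] edge_compat_refl by simp
    next
      case False
      then have "compatible R S (edge x y) (edge u v)"
        using comp xy uv unfolding pairwise_def X_def arcs_def by blast
      then show ?thesis
        using compatible_edge_compat[OF W] xy uv unfolding X_def arcs_def by blast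
    qed
    then have compat: "edge_compat e f" if "e \<in> X" "f \<in> X" for e f
      using that by (cases e; cases f) blast
    obtain F where F: "binary_forest (parts_in S W) F" "X \<subseteq> arcs (generated_tree (parts_in S W) F)"
      using edge_compat_extend[OF X compat] by blast
    have "T \<inter> edges_in W \<subseteq> generated_tree (parts_in S W) F"
    proof
      fix e assume e: "e \<in> T \<inter> edges_in W"
      then obtain A B where "e = edge A B"
        using edges_in_cases[OF W] by blast
      then show "e \<in> generated_tree (parts_in S W) F"
        using e F(2) unfolding X_def arcs_def by blast
    qed
    then show ?thesis
      using F(1) by blast
  qed
  then obtain f where f: "\<And>W. W \<in> R \<Longrightarrow> binary_forest (parts_in S W) (f W)"
    "\<And>W. W \<in> R \<Longrightarrow> T \<inter> edges_in W \<subseteq> generated_tree (parts_in S W) (f W)"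
    by metis
  let ?T' = "\<Union>W\<in>R. generated_tree (parts_in S W) (f W)"
  have "cluster_morphism R S ?T'"
    unfolding cluster_morphism_def using f(1) by blast
  moreover have "T \<subseteq> ?T'"
    using T f(2) unfolding rel_edges_def by blast
  ultimately show ?thesis
    by (rule that)
qed

lemma cluster_morphism_compatible:
  assumes "cluster_morphism R S T"
  shows "pairwise (compatible R S) T"
  using assms cluster_morphism_subset_rel_edges[OF assms] by (auto simp: pairwise_def compatible_def)

end

theorem theorem1p20:
  fixes n :: nat
    and R S :: "nat set set"
    and T :: "(nat set \<Rightarrow>\<^sub>0 int) set"
  assumes "noncrossing_partition {1..n} R"
    and "noncrossing_partition {1..n} S"
    and "refines {1..n} S R"
    and "T \<subseteq> rel_edges S R"
  shows "cluster_morphism R S T \<longleftrightarrow>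
    pairwise (compatible R S) T \<and>
    (\<forall>T'. T \<subseteq> T' \<and> T' \<subseteq> rel_edges S R \<and> pairwise (compatible R S) T' \<longrightarrow> T' = T)"
proof -
  interpret nc_refinement "{1..n}" R S
    using assms by unfold_locales auto
  show ?thesis
  proof (intro iffI conjI allI impI; (elim conjE)?)
    assume T: "cluster_morphism R S T"
    show "pairwise (compatible R S) T"
      by (rule cluster_morphism_compatible[OF T])
    fix T' assume T': "T \<subseteq> T'" "T' \<subseteq> rel_edges S R" "pairwise (compatible R S) T'"
    \<comment> \<open>\<open>T'\<close> is squeezed between the cluster morphisms \<open>T\<close>
      and \<open>U\<close>, which coincide.\<close>
    obtain U where "cluster_morphism R S U" "T' \<subseteq> U"
      by (rule compatible_extend[OF T'(2,3)])
    then show "T' = T"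
      using cluster_morphism_subset_eq[OF T, of U] T'(1) by blast
  next
    assume comp: "pairwise (compatible R S) T"
      and max: "\<forall>T'. T \<subseteq> T' \<and> T' \<subseteq> rel_edges S R \<and> pairwise (compatible R S) T' \<longrightarrow> T' = T"
    \<comment> \<open>The extension \<open>U\<close> is itself pairwise compatible, so the
      maximality of \<open>T\<close> applies to it.\<close>
    obtain U where U: "cluster_morphism R S U" "T \<subseteq> U"
      by (rule compatible_extend[OF assms(4) comp])
    then have "U = T"
      using max cluster_morphism_subset_rel_edges cluster_morphism_compatible by blast
    then show "cluster_morphism R S T"
      using U(1) by simp
  qed
qed

end
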